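(* Let $A_1,\dots,A_m,B$ be real symmetric $n\times n$ matrices such that the semidefinite system $$(P_{SD})\qquad \sum_{i=1}^m x_iA_i\preceq B$$ is feasible, and suppose that for some $0\le r\le n$ the matrix $Z=\begin{pmatrix} I_r & 0 \\ 0 & 0 \end{pmatrix}$ is a maximum rank slack of $(P_{SD})$. Then: (a) $(P_{SD})$ is badly behaved if and only if it has a bad reformulation, i.e., an elementary reformulation in bad normal form. (b) $(P_{SD})$ is well behaved if and only if it has a good reformulation, i.e., an elementary reformulation in good normal form.
   Context: For symmetric matrices $S,T$, $S\preceq T$ means $T-S$ is positive semidefinite (psd), $S\succ 0$ means $S$ is symmetric positive definite, and $S\bullet T:=\operatorname{trace}(ST)$. For $c\in\mathbb R^m$ consider the primal-dual pair $$(\text{SDP-P})\quad \sup\Big\{\sum_{i=1}^m c_ix_i : \sum_{i=1}^m x_iA_i\preceq B\Big\},\qquad (\text{SDP-D})\quad \inf\{B\bullet Y: A_i\bullet Y=c_i\ (i=1,\dots,m),\ Y\succeq 0\}.$$ A feasible system $(P_{SD})$ is badly behaved if there is $c\in\mathbb R^m$ for which the optimal value of (SDP-P) is finite but (SDP-D) has no feasible solution $Y$ whose value $B\bullet Y$ equals it. It is well behaved if it is not badly behaved. A slack of $(P_{SD})$ is a psd matrix of the form $B-\sum_{i=1}^m x_iA_i$ with $x\in\mathbb R^m$; a maximum rank slack is a slack whose rank is largest among all slacks. Elementary reformulation: a semidefinite system obtained from $(P_{SD})$ by a finite sequence of the following operations, in any order (not all need be used): (i) choose an invertible matrix $T=\begin{pmatrix}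 I_r & 0 \\ 0 & M \end{pmatrix}$ and replace every $A_i$ by $T^TA_iT$ and $B$ by $T^TBT$; (ii) choose $\mu\in\mathbb R^m$ and replace $B$ by $B+\sum_{j=1}^m\mu_jA_j$; (iii) choose indices $i\ne j$ and exchange $A_i$ and $A_j$; (iv) choose $\lambda\in\mathbb R^m$ and an index $i$ with $\lambda_i\neq0$, and replace $A_i$ by $\sum_{j=1}^m\lambda_jA_j$. (In these operations $A_i$ and $B$ denote the current matrices.) Bad normal form: a system $$\sum_{i=1}^k x_i\begin{pmatrix} F_i & 0 \\ 0 & 0 \end{pmatrix}+\sum_{i=k+1}^m x_i\begin{pmatrix} F_i & G_i \\ G_i^T & H_i \end{pmatrix}\preceq\begin{pmatrix} I_r & 0 \\ 0 & 0 \end{pmatrix}=Z$$ with $0\le k<m$ and upper left blocks $r\times r$, such that: $Z$ is a maximum rank slack of this system; the matrices $\begin{pmatrix} G_i \\ H_i \end{pmatrix}$ $(i=k+1,\dots,m)$ are linearly independent; and $H_m\succeq0$. Good normal form: a system of the same displayed shape, with $0\le k\le m$ and upper left blocks $r\times r$, such that: $Z$ is a maximum rank slack of this system; the matrices $H_i$ $(i=k+1,\dots,m)$ are linearly independent; and there is $U\succ0$ with $H_{k+1}\bullet U=\dots=H_m\bullet U=0$. *)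

theory Defs
  imports "Jordan_Normal_Form.DL_Rank" "HOL-Library.Extended_Real"
begin

(* A family of m matrices is a function on indices of type nat, of which only the values
   at {1..m} matter; vectors x, c in R^m are represented in the same way.
   Matrix sums are entrywise because the type mat, whose elements carry their own dimensions,
   is not a commutative monoid. *)

definition sym_mat :: "nat \<Rightarrow> real mat \<Rightarrow> bool" where
  "sym_mat n S \<longleftrightarrow> S \<in> carrier_mat n n \<and> transpose_mat S = S"

definition psd :: "nat \<Rightarrow> real mat \<Rightarrow> bool" where
  "psd n S \<longleftrightarrow> sym_mat n S \<and> (\<forall>v \<in> carrier_vec n. 0 \<le> v \<bullet> (S *\<^sub>v v))"

definition posdef :: "nat \<Rightarrow> real mat \<Rightarrow> bool" where
  "posdef n S \<longleftrightarrow> sym_mat n S \<and> (\<forall>v \<in> carrier_vec n. v \<noteq> 0\<^sub>v n \<longrightarrow> 0 < v \<bullet> (S *\<^sub>v v))"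

definition loewner_le :: "nat \<Rightarrow> real mat \<Rightarrow> real mat \<Rightarrow> bool" where
  "loewner_le n S T \<longleftrightarrow> psd n (T - S)"

definition mat_trace :: "real mat \<Rightarrow> real" where
  "mat_trace S = (\<Sum>i<dim_row S. S $$ (i, i))"

definition mat_inner :: "real mat \<Rightarrow> real mat \<Rightarrow> real" where
  "mat_inner S T = mat_trace (S * T)"

definition mat_lincomb ::
  "nat \<Rightarrow> nat \<Rightarrow> nat set \<Rightarrow> (nat \<Rightarrow> real) \<Rightarrow> (nat \<Rightarrow> real mat) \<Rightarrow> real mat" where
  "mat_lincomb p q I x A = mat p q (\<lambda>(a, b). \<Sum>i\<in>I. x i * A i $$ (a, b))"

definition mat_lin_indep :: "nat \<Rightarrow> nat \<Rightarrow> nat set \<Rightarrow> (nat \<Rightarrow> real mat) \<Rightarrow> bool" where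
  "mat_lin_indep p q I A \<longleftrightarrow>
     (\<forall>x. mat_lincomb p q I x A = 0\<^sub>m p q \<longrightarrow> (\<forall>i\<in>I. x i = 0))"

definition sd_feasible_point ::
  "nat \<Rightarrow> nat \<Rightarrow> (nat \<Rightarrow> real mat) \<Rightarrow> real mat \<Rightarrow> (nat \<Rightarrow> real) \<Rightarrow> bool" where
  "sd_feasible_point n m A B x \<longleftrightarrow> loewner_le n (mat_lincomb n n {1..m} x A) B"

definition sd_feasible :: "nat \<Rightarrow> nat \<Rightarrow> (nat \<Rightarrow> real mat) \<Rightarrow> real mat \<Rightarrow> bool" where
  "sd_feasible n m A B \<longleftrightarrow> (\<exists>x. sd_feasible_point n m A B x)"

definition sdp_primal_value ::
  "nat \<Rightarrow> nat \<Rightarrow> (nat \<Rightarrow> real mat) \<Rightarrow> real mat \<Rightarrow> (nat \<Rightarrow> real) \<Rightarrow> ereal" where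
  "sdp_primal_value n m A B c =
     (SUP x \<in> {x. sd_feasible_point n m A B x}. ereal (\<Sum>i=1..m. c i * x i))"

definition sdp_dual_feasible ::
  "nat \<Rightarrow> nat \<Rightarrow> (nat \<Rightarrow> real mat) \<Rightarrow> (nat \<Rightarrow> real) \<Rightarrow> real mat \<Rightarrow> bool" where
  "sdp_dual_feasible n m A c Y \<longleftrightarrow> psd n Y \<and> (\<forall>i\<in>{1..m}. mat_inner (A i) Y = c i)"

definition badly_behaved :: "nat \<Rightarrow> nat \<Rightarrow> (nat \<Rightarrow> real mat) \<Rightarrow> real mat \<Rightarrow> bool" where
  "badly_behaved n m A B \<longleftrightarrow>
     (\<exists>c. \<bar>sdp_primal_value n m A B c\<bar> \<noteq> \<infinity> \<and>
          \<not> (\<exists>Y. sdp_dual_feasible n m A c Y \<and>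
                 ereal (mat_inner B Y) = sdp_primal_value n m A B c))"

definition well_behaved :: "nat \<Rightarrow> nat \<Rightarrow> (nat \<Rightarrow> real mat) \<Rightarrow> real mat \<Rightarrow> bool" where
  "well_behaved n m A B \<longleftrightarrow> \<not> badly_behaved n m A B"

definition is_slack :: "nat \<Rightarrow> nat \<Rightarrow> (nat \<Rightarrow> real mat) \<Rightarrow> real mat \<Rightarrow> real mat \<Rightarrow> bool" where
  "is_slack n m A B S \<longleftrightarrow> psd n S \<and> (\<exists>x. S = B - mat_lincomb n n {1..m} x A)"

definition max_rank_slack ::
  "nat \<Rightarrow> nat \<Rightarrow> (nat \<Rightarrow> real mat) \<Rightarrow> real mat \<Rightarrow> real mat \<Rightarrow> bool" where
  "max_rank_slack n m A B S \<longleftrightarrow>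
     is_slack n m A B S \<and>
     (\<forall>S'. is_slack n m A B S' \<longrightarrow> vec_space.rank n S' \<le> vec_space.rank n S)"

definition block_Z :: "nat \<Rightarrow> nat \<Rightarrow> real mat" where
  "block_Z n r =
     four_block_mat (1\<^sub>m r) (0\<^sub>m r (n - r)) (0\<^sub>m (n - r) r) (0\<^sub>m (n - r) (n - r))"

inductive elementary_reformulation ::
  "nat \<Rightarrow> nat \<Rightarrow> nat \<Rightarrow> (nat \<Rightarrow> real mat) \<Rightarrow> real mat \<Rightarrow> (nat \<Rightarrow> real mat) \<Rightarrow> real mat \<Rightarrow> bool"
  for n r m :: nat and A :: "nat \<Rightarrow> real mat" and B :: "real mat" where
  refl: "elementary_reformulation n r m A B A B"
| rotate: "elementary_reformulation n r m A B
      (\<lambda>i. transpose_mat T * A' i * T) (transpose_mat T * B' * T)"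
  if "elementary_reformulation n r m A B A' B'"
    and "M \<in> carrier_mat (n - r) (n - r)"
    and "T = four_block_mat (1\<^sub>m r) (0\<^sub>m r (n - r)) (0\<^sub>m (n - r) r) M"
    and "invertible_mat T"
| shift: "elementary_reformulation n r m A B A' (B' + mat_lincomb n n {1..m} \<mu> A')"
  if "elementary_reformulation n r m A B A' B'"
| exchange: "elementary_reformulation n r m A B (A'(i := A' j, j := A' i)) B'"
  if "elementary_reformulation n r m A B A' B'"
    and "i \<in> {1..m}" and "j \<in> {1..m}" and "i \<noteq> j"
| combine: "elementary_reformulation n r m A B (A'(i := mat_lincomb n n {1..m} l A')) B'"
  if "elementary_reformulation n r m A B A' B'"
    and "i \<in> {1..m}" and "l i \<noteq> 0" for l :: "nat \<Rightarrow> real"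

definition normal_shape ::
  "nat \<Rightarrow> nat \<Rightarrow> nat \<Rightarrow> nat \<Rightarrow> (nat \<Rightarrow> real mat) \<Rightarrow> real mat \<Rightarrow>
   (nat \<Rightarrow> real mat) \<Rightarrow> (nat \<Rightarrow> real mat) \<Rightarrow> (nat \<Rightarrow> real mat) \<Rightarrow> bool" where
  "normal_shape n r m k A B F G H \<longleftrightarrow>
     B = block_Z n r \<and>
     (\<forall>i\<in>{1..m}. sym_mat r (F i)) \<and>
     (\<forall>i\<in>{k+1..m}. G i \<in> carrier_mat r (n - r) \<and> sym_mat (n - r) (H i)) \<and>
     (\<forall>i\<in>{1..k}. A i =
        four_block_mat (F i) (0\<^sub>m r (n - r)) (0\<^sub>m (n - r) r) (0\<^sub>m (n - r) (n - r))) \<and>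
     (\<forall>i\<in>{k+1..m}. A i = four_block_mat (F i) (G i) (transpose_mat (G i)) (H i))"

definition bad_normal_form ::
  "nat \<Rightarrow> nat \<Rightarrow> nat \<Rightarrow> (nat \<Rightarrow> real mat) \<Rightarrow> real mat \<Rightarrow> bool" where
  "bad_normal_form n r m A B \<longleftrightarrow>
     (\<exists>k F G H. k < m \<and> normal_shape n r m k A B F G H \<and>
        max_rank_slack n m A B (block_Z n r) \<and>
        mat_lin_indep n (n - r) {k+1..m} (\<lambda>i. G i @\<^sub>r H i) \<and>
        psd (n - r) (H m))"

definition good_normal_form ::
  "nat \<Rightarrow> nat \<Rightarrow> nat \<Rightarrow> (nat \<Rightarrow> real mat) \<Rightarrow> real mat \<Rightarrow> bool" where
  "good_normal_form n r m A B \<longleftrightarrow>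
     (\<exists>k F G H. k \<le> m \<and> normal_shape n r m k A B F G H \<and>
        max_rank_slack n m A B (block_Z n r) \<and>
        mat_lin_indep (n - r) (n - r) {k+1..m} H \<and>
        (\<exists>U. posdef (n - r) U \<and> (\<forall>i\<in>{k+1..m}. mat_inner (H i) U = 0)))"

definition has_bad_reformulation ::
  "nat \<Rightarrow> nat \<Rightarrow> nat \<Rightarrow> (nat \<Rightarrow> real mat) \<Rightarrow> real mat \<Rightarrow> bool" where
  "has_bad_reformulation n r m A B \<longleftrightarrow>
     (\<exists>A' B'. elementary_reformulation n r m A B A' B' \<and> bad_normal_form n r m A' B')"

definition has_good_reformulation ::
  "nat \<Rightarrow> nat \<Rightarrow> nat \<Rightarrow> (nat \<Rightarrow> real mat) \<Rightarrow> real mat \<Rightarrow> bool" where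
  "has_good_reformulation n r m A B \<longleftrightarrow>
     (\<exists>A' B'. elementary_reformulation n r m A B A' B' \<and> good_normal_form n r m A' B')"

end

theory Submission
  imports Defs
begin

text \<open>
  If \<open>Z\<close> is a maximum rank slack, every slack vanishes outside the upper left \<open>r \<times> r\<close> block, since
  otherwise its average with \<open>Z\<close> would have larger rank. In bad normal form this forces \<open>x\<^sub>m = 0\<close>
  at all feasible points, and the objective \<open>- x\<^sub>m\<close> has value \<open>0\<close> that no dual solution attains.
  In good normal form only \<open>x\<^sub>1, \<dots>, x\<^sub>k\<close> matter, the reduced problem satisfies Slater's condition at
  \<open>0\<close>, and its dual solution extends to the full matrix. Elementary reformulations do not affect bad
  behaviour, so it remains to see that one of the two reformulations exists: after elimination with
  as many vanishing \<open>(G\<^sub>i, H\<^sub>i)\<close> as possible, either some nontrivial combination of the remaining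
  \<open>H\<^sub>i\<close> is psd, or, by separation, some \<open>U \<succ> 0\<close> is orthogonal to all of them.

  The convexity needed is the weak separation of a convex set in \<open>\<real>\<^sup>J\<close> from a point outside it, which
  has an algebraic proof by induction on the finite set \<open>J\<close>. Matrices are mostly handled as functions
  of two indices ranging over a finite set.
\<close>

section \<open>Separation and positive semidefinite matrices\<close>

text \<open>The separation is only weak: the functional may vanish on the whole set. In exchange the
  convex sets may be arbitrary, with no closedness to verify, but each application has to exclude
  degeneracy by its own argument. In all three applications the separating functional is itself the
  decisive object. In \<open>slater_strong_duality\<close> it is a multiple of the dual optimum,
  which gives attainment without compactness; the factor is nonzero because the identity is a slack.
  In \<open>posdef_orthogonal_exists\<close> its coefficients produce a psd combination of the
  \<open>H i\<close>. In \<open>psd_with_prescribed_products\<close> they produce a psd combination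
  orthogonal to a definite matrix, which must be zero. Matrices live on arbitrary finite index sets
  because a principal submatrix is then the same function on a smaller set, so that the elimination
  step and the rank argument need no renumbering.\<close>

lemma slope_nonneg:
  fixes a b :: real
  assumes "\<And>t. t > 0 \<Longrightarrow> 0 \<le> a + t * b"
  shows "0 \<le> b"
proof (rule ccontr)
  assume "\<not> 0 \<le> b"
  then have b: "b < 0" by simp
  \<comment> \<open>At this \<open>t\<close> the affine function has the value
    \<open>a - \<bar>a\<bar> - 1\<close>, which is negative.\<close>
  have "0 \<le> a + ((\<bar>a\<bar> + 1) / - b) * b" using b by (intro assms) (simp add: field_simps)
  then show False using b by simp
qed

lemma slope_zero:
  fixes a b :: real
  assumes "\<And>t. 0 \<le> a + t * b"
  shows "b = 0"
  using slope_nonneg[of a b] slope_nonneg[of a "- b"] assms assms[of "- t" for t]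
  by (metis add.inverse_neutral eq_iff minus_mult_commute neg_0_le_iff_le)

text \<open>The passage to the limit \<open>t = 0\<close> without limits: putting
  \<open>1 / t\<close> for \<open>t\<close> and multiplying by \<open>t\<close> exchanges the roles
  of \<open>a\<close> and \<open>b\<close>.\<close>

lemma intercept_nonneg:
  fixes a b :: real
  assumes "\<And>t. t > 0 \<Longrightarrow> 0 \<le> a + t * b"
  shows "0 \<le> a"
proof (rule slope_nonneg)
  fix t :: real assume t: "t > 0"
  have "0 \<le> t * (a + (1 / t) * b)" using t assms[of "1 / t"] by simp
  also have "\<dots> = b + t * a" using t by (simp add: field_simps)
  finally show "0 \<le> b + t * a" .
qed

text \<open>Induction on the coordinates. If coordinate \<open>i\<close> does not change sign on
  \<open>C\<close>, a signed unit vector separates. Otherwise the slice of \<open>C\<close> in the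
  hyperplane \<open>c i = 0\<close> is convex, nonempty and avoids the origin in the coordinates
  \<open>J\<close>; a functional for the slice exists by induction and only its coefficient at
  \<open>i\<close> remains to be chosen.\<close>

lemma weak_separation_from_origin:
  fixes C :: "('i \<Rightarrow> real) set"
  assumes "finite J" "C \<noteq> {}"
    and "\<And>c d u. \<lbrakk>c \<in> C; d \<in> C; 0 \<le> u; u \<le> 1\<rbrakk> \<Longrightarrow> (\<lambda>j. u * c j + (1 - u) * d j) \<in> C"
    and "\<And>c. c \<in> C \<Longrightarrow> \<exists>j\<in>J. c j \<noteq> 0"
  shows "\<exists>y. (\<exists>j\<in>J. y j \<noteq> 0) \<and> (\<forall>c\<in>C. 0 \<le> (\<Sum>j\<in>J. y j * c j))"
  using assms
proof (induction J arbitrary: C rule: finite_induct)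
  case empty
  then show ?case by blast
next
  case (insert i J)
  note conv = insert.prems(2)
  have unit: "(\<Sum>j\<in>insert i J. (if j = i then s else 0) * c j) = s * c i"
    for s :: real and c :: "'i \<Rightarrow> real"
    using insert.hyps by (simp add: if_distrib[of "\<lambda>x. x * _"] cong: if_cong)
  show ?case
  proof (cases "(\<exists>p\<in>C. p i > 0) \<and> (\<exists>q\<in>C. q i < 0)")
    case False
    then consider "\<forall>c\<in>C. c i \<ge> 0" | "\<forall>c\<in>C. c i \<le> 0" by (meson not_le)
    then show ?thesis
    proof cases
      case 1
      then show ?thesis
        by (intro exI[of _ "\<lambda>j. if j = i then 1 else 0"]) (simp only: unit, auto)
    next
      case 2
      then show ?thesis
        by (intro exI[of _ "\<lambda>j. if j = i then -1 else 0"]) (simp only: unit, auto)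
    qed
  next
    case True
    define D where "D = {c \<in> C. c i = 0}"
    \<comment> \<open>The weight \<open>- q i / (p i - q i)\<close> marks the point where the
      segment from \<open>q\<close> to \<open>p\<close> crosses the hyperplane.\<close>
    have mix: "(\<lambda>j. (- q i / (p i - q i)) * p j + (1 - (- q i / (p i - q i))) * q j) \<in> D"
      if "p \<in> C" "q \<in> C" "p i > 0" "q i < 0" for p q
    proof -
      let ?u = "- q i / (p i - q i)"
      have "0 \<le> ?u" "?u \<le> 1" using that by (auto simp: field_simps)
      moreover have "?u * p i + (1 - ?u) * q i = 0" using that by (simp add: field_simps)
      ultimately show ?thesis using conv[of p q ?u] that unfolding D_def by simp
    qed
    have "\<exists>y. (\<exists>j\<in>J. y j \<noteq> 0) \<and> (\<forall>c\<in>D. 0 \<le> (\<Sum>j\<in>J. y j * c j))"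
    proof (rule insert.IH)
      show "D \<noteq> {}" using True mix by blast
      show "(\<lambda>j. u * c j + (1 - u) * d j) \<in> D" if "c \<in> D" "d \<in> D" "0 \<le> u" "u \<le> 1" for c d u
        using that conv unfolding D_def by simp
      show "\<exists>j\<in>J. c j \<noteq> 0" if "c \<in> D" for c
        using that insert.prems(3)[of c] unfolding D_def by auto
    qed
    then obtain y where y: "\<exists>j\<in>J. y j \<noteq> 0" "\<And>c. c \<in> D \<Longrightarrow> 0 \<le> (\<Sum>j\<in>J. y j * c j)"
      by blast
    define f where "f c = (\<Sum>j\<in>J. y j * c j)" for c
    \<comment> \<open>Nonnegativity at the crossing point, cleared of its denominator: every lower
      bound on the missing coefficient, imposed by some \<open>p\<close>, lies below every upper
      bound, imposed by some \<open>q\<close>.\<close>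
    have cross: "- f p / p i \<le> f q / - q i" if pq: "p \<in> C" "q \<in> C" "p i > 0" "q i < 0" for p q
    proof -
      let ?u = "- q i / (p i - q i)"
      have "0 \<le> f (\<lambda>j. ?u * p j + (1 - ?u) * q j)"
        using y(2)[OF mix[OF pq]] unfolding f_def .
      also have "\<dots> = ?u * f p + (1 - ?u) * f q"
        unfolding f_def sum_distrib_left sum.distrib[symmetric]
        by (auto intro!: sum.cong simp only: distrib_left mult.left_commute)
      also have "\<dots> = (- q i * f p + p i * f q) / (p i - q i)"
      proof -
        have "1 - ?u = p i / (p i - q i)" using pq by (simp add: field_simps)
        then show ?thesis by (simp add: add_divide_distrib diff_divide_distrib)
      qed
      finally have "0 \<le> - q i * f p + p i * f q"
        using pq by (simp add: zero_le_divide_iff)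
      then show ?thesis using pq by (simp add: field_simps)
    qed
    \<comment> \<open>The admissible values for the missing coordinate form an interval, as in the one-step
      extension of the Hahn-Banach theorem.\<close>
    define t where "t = (SUP p\<in>{p\<in>C. p i > 0}. - f p / p i)"
    obtain p0 q0 where pq0: "p0 \<in> C" "p0 i > 0" "q0 \<in> C" "q0 i < 0" using True by blast
    have lower: "- f p / p i \<le> t" if "p \<in> C" "p i > 0" for p
      unfolding t_def
    proof (rule cSUP_upper)
      show "bdd_above ((\<lambda>p. - f p / p i) ` {p \<in> C. 0 < p i})"
        using cross pq0 by (intro bdd_aboveI[of _ "f q0 / - q0 i"]) auto
    qed (use that in auto)
    have upper: "t \<le> f q / - q i" if "q \<in> C" "q i < 0" for q
      unfolding t_def by (rule cSUP_least) (use pq0 cross that in auto)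
    let ?y = "y(i := t)"
    have "(\<Sum>j\<in>insert i J. ?y j * c j) = t * c i + f c" for c
      unfolding f_def using insert.hyps by (auto intro!: sum.cong)
    moreover have "0 \<le> t * c i + f c" if c: "c \<in> C" for c
    proof (cases "c i" "0 :: real" rule: linorder_cases)
      case less
      then show ?thesis using upper[OF c] by (simp add: field_simps)
    next
      case equal
      then show ?thesis using y(2)[of c] c unfolding D_def f_def by simp
    next
      case greater
      then show ?thesis using lower[OF c] by (simp add: field_simps)
    qed
    moreover have "\<exists>j\<in>insert i J. ?y j \<noteq> 0" using y(1) insert.hyps by (metis fun_upd_other insertCI)
    ultimately show ?thesis by (intro exI[of _ ?y]) auto
  qed
qed

section \<open>Quadratic forms and Frobenius products on finite index sets\<close>

definition qform :: "'a set \<Rightarrow> ('a \<Rightarrow> 'a \<Rightarrow> real) \<Rightarrow> ('a \<Rightarrow> real) \<Rightarrow> real" where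
  "qform I P w = (\<Sum>a\<in>I. \<Sum>b\<in>I. P a b * (w a * w b))"

text \<open>Entries are paired without transposition, unlike in \<open>mat_inner\<close>; the two
  agree once the second factor is symmetric (\<open>mat_inner_eq_frob\<close>). A quadratic form is
  then the product with a rank one matrix.\<close>

definition frob :: "'a set \<Rightarrow> ('a \<Rightarrow> 'a \<Rightarrow> real) \<Rightarrow> ('a \<Rightarrow> 'a \<Rightarrow> real) \<Rightarrow> real" where
  "frob I P Q = (\<Sum>a\<in>I. \<Sum>b\<in>I. P a b * Q a b)"

definition symmetric_on :: "'a set \<Rightarrow> ('a \<Rightarrow> 'a \<Rightarrow> real) \<Rightarrow> bool" where
  "symmetric_on I P \<longleftrightarrow> (\<forall>a\<in>I. \<forall>b\<in>I. P a b = P b a)"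

definition psd_on :: "'a set \<Rightarrow> ('a \<Rightarrow> 'a \<Rightarrow> real) \<Rightarrow> bool" where
  "psd_on I P \<longleftrightarrow> symmetric_on I P \<and> (\<forall>w. 0 \<le> qform I P w)"

definition posdef_on :: "'a set \<Rightarrow> ('a \<Rightarrow> 'a \<Rightarrow> real) \<Rightarrow> bool" where
  "posdef_on I P \<longleftrightarrow> symmetric_on I P \<and> (\<forall>w. (\<exists>a\<in>I. w a \<noteq> 0) \<longrightarrow> 0 < qform I P w)"

lemma qform_eq_frob: "qform I P w = frob I P (\<lambda>a b. w a * w b)"
  unfolding qform_def frob_def ..

lemma frob_commute: "frob I P Q = frob I Q P"
  unfolding frob_def by (simp add: mult.commute)

lemma frob_cong:
  assumes "\<And>a b. a \<in> I \<Longrightarrow> b \<in> I \<Longrightarrow> P a b = P' a b" "\<And>a b. a \<in> I \<Longrightarrow> b \<in> I \<Longrightarrow> Q a b = Q' a b"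
  shows "frob I P Q = frob I P' Q'"
  unfolding frob_def by (auto intro!: sum.cong simp: assms)

lemma qform_cong:
  assumes "\<And>a b. a \<in> I \<Longrightarrow> b \<in> I \<Longrightarrow> P a b = P' a b" "\<And>a. a \<in> I \<Longrightarrow> w a = w' a"
  shows "qform I P w = qform I P' w'"
  unfolding qform_def by (auto intro!: sum.cong simp: assms)

lemma psd_on_cong:
  assumes "\<And>a b. a \<in> I \<Longrightarrow> b \<in> I \<Longrightarrow> P a b = P' a b"
  shows "psd_on I P \<longleftrightarrow> psd_on I P'"
proof -
  have "qform I P w = qform I P' w" for w
    by (rule qform_cong) (auto simp: assms)
  then show ?thesis unfolding psd_on_def symmetric_on_def by (simp add: assms)
qed

lemma frob_add_left: "frob I (\<lambda>a b. P a b + Q a b) R = frob I P R + frob I Q R"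
  unfolding frob_def by (simp add: algebra_simps sum.distrib)

lemma frob_diff_left: "frob I (\<lambda>a b. P a b - Q a b) R = frob I P R - frob I Q R"
  unfolding frob_def by (simp add: algebra_simps sum_subtractf)

lemma frob_scale_left: "frob I (\<lambda>a b. s * P a b) R = s * frob I P R"
  unfolding frob_def by (simp add: sum_distrib_left algebra_simps)

lemma frob_sum_left: "frob I (\<lambda>a b. \<Sum>k\<in>K. P k a b) R = (\<Sum>k\<in>K. frob I (P k) R)"
proof -
  have "(\<Sum>b\<in>I. (\<Sum>k\<in>K. P k a b) * R a b) = (\<Sum>k\<in>K. \<Sum>b\<in>I. P k a b * R a b)" for a
    unfolding sum_distrib_right by (rule sum.swap)
  then show ?thesis unfolding frob_def by (simp add: sum.swap[of _ I K])
qed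

lemma frob_comb_left: "frob I (\<lambda>a b. \<Sum>k\<in>K. x k * P k a b) R = (\<Sum>k\<in>K. x k * frob I (P k) R)"
  by (simp add: frob_sum_left frob_scale_left)

lemma frob_kronecker:
  assumes "finite I"
  shows "frob I (\<lambda>a b. of_bool (a = b)) Q = (\<Sum>a\<in>I. Q a a)"
  unfolding frob_def using assms by (auto intro!: sum.cong simp: of_bool_def sum.delta if_distrib[of "\<lambda>x. x * _"] cong: if_cong)

lemma qform_kronecker:
  assumes "finite I"
  shows "qform I (\<lambda>a b. of_bool (a = b)) w = (\<Sum>a\<in>I. (w a)\<^sup>2)"
  unfolding qform_eq_frob frob_kronecker[OF assms] by (simp add: power2_eq_square)

lemma qform_outer: "qform I (\<lambda>a b. v a * v b) w = (\<Sum>a\<in>I. v a * w a)\<^sup>2"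
  unfolding qform_def power2_eq_square sum_product
  by (auto intro!: sum.cong simp: algebra_simps)

lemma qform_unit:
  assumes "finite I" "a \<in> I"
  shows "qform I P (\<lambda>x. of_bool (x = a)) = P a a"
proof -
  have "(\<Sum>b\<in>I. P c b * (of_bool (c = a) * of_bool (b = a))) = (if c = a then P a a else 0)" for c
    using assms by (simp add: of_bool_def if_distrib[of "\<lambda>x. _ * x"] cong: if_cong)
  then show ?thesis unfolding qform_def using assms by simp
qed

text \<open>The form as a quadratic polynomial in one coordinate. Its minimum over \<open>t\<close>
  yields the Schur complement in \<open>psd_on_decomposition\<close>; for \<open>P j j = 0\<close>
  it degenerates to an affine function, which \<open>psd_on_zero_diag\<close> exploits.\<close>

lemma qform_shift_unit:
  assumes I: "finite I" "j \<in> I" and sym: "symmetric_on I P"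
  shows "qform I P (\<lambda>a. w a + (if a = j then t else 0)) =
    qform I P w + 2 * t * (\<Sum>b\<in>I. P j b * w b) + t\<^sup>2 * P j j"
proof -
  let ?d = "\<lambda>a. if a = j then t else 0"
  have e: "P a b * ((w a + ?d a) * (w b + ?d b)) =
      P a b * (w a * w b) + (if a = j then t * (P a b * w b) else 0)
      + (if b = j then t * (P a b * w a) else 0)
      + (if a = j then (if b = j then t\<^sup>2 * P a b else 0) else 0)" for a b
    by (simp add: algebra_simps power2_eq_square)
  have "(\<Sum>a\<in>I. t * (P a j * w a)) = (\<Sum>b\<in>I. t * (P j b * w b))"
    using sym I(2) unfolding symmetric_on_def by (intro sum.cong) auto
  moreover have "(\<Sum>a\<in>I. \<Sum>b\<in>I. if a = j then f b else 0) = sum f I" for f :: "'a \<Rightarrow> real"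
  proof -
    have "(\<Sum>b\<in>I. if a = j then f b else 0) = (if a = j then sum f I else 0)" for a by simp
    then show ?thesis using I by simp
  qed
  ultimately show ?thesis
    unfolding qform_def e sum.distrib using I
    by (simp add: sum_distrib_left algebra_simps if_distrib[of "sum _"] cong: if_cong)
qed


lemma symmetric_on_comb:
  assumes "\<And>k. k \<in> K \<Longrightarrow> symmetric_on I (P k)"
  shows "symmetric_on I (\<lambda>a b. \<Sum>k\<in>K. x k * P k a b)"
  using assms unfolding symmetric_on_def by (auto intro!: sum.cong)

lemma symmetric_on_diff:
  assumes "symmetric_on I P" "symmetric_on I Q"
  shows "symmetric_on I (\<lambda>a b. P a b - Q a b)"
  using assms unfolding symmetric_on_def by simp

lemma psd_on_diag_nonneg:
  assumes "finite I" "psd_on I P" "a \<in> I"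
  shows "0 \<le> P a a"
  using assms qform_unit[of I a P] unfolding psd_on_def by metis

text \<open>Along the unit vector of \<open>b\<close> plus \<open>t\<close> times that of
  \<open>a\<close> the form equals \<open>P b b + 2 * t * P a b\<close>; being bounded below for all
  real \<open>t\<close>, it has slope zero.\<close>

lemma psd_on_zero_diag:
  assumes I: "finite I" and P: "psd_on I P" and ab: "a \<in> I" "b \<in> I" and zero: "P a a = 0"
  shows "P a b = 0" "P b a = 0"
proof -
  have "2 * P a b = 0"
  proof (rule slope_zero)
    fix t :: real
    have "(\<Sum>c\<in>I. P a c * of_bool (c = b)) = P a b"
      using I ab by (simp add: of_bool_def if_distrib[of "\<lambda>x. _ * x"] cong: if_cong)
    then have "qform I P (\<lambda>x. of_bool (x = b) + (if x = a then t else 0)) = P b b + t * (2 * P a b)"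
      using qform_shift_unit[OF I ab(1), of P "\<lambda>x. of_bool (x = b)" t] P zero qform_unit[OF I ab(2), of P]
      unfolding psd_on_def by simp
    then show "0 \<le> P b b + t * (2 * P a b)" using P unfolding psd_on_def by metis
  qed
  then show "P a b = 0" by simp
  then show "P b a = 0" using P ab unfolding psd_on_def symmetric_on_def by metis
qed

lemma psd_on_subset:
  assumes "finite I" "J \<subseteq> I" "psd_on I P"
  shows "psd_on J P"
proof -
  have "qform J P w = qform I P (\<lambda>a. if a \<in> J then w a else 0)" for w
  proof -
    have "(\<Sum>b\<in>J. P a b * (w a * w b)) =
        (\<Sum>b\<in>I. P a b * (w a * (if b \<in> J then w b else 0)))" for a
      using assms(1,2) by (intro sum.mono_neutral_cong_left) auto
    then show ?thesis
      unfolding qform_def using assms(1,2) by (intro sum.mono_neutral_cong_left) auto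
  qed
  moreover have "symmetric_on J P" using assms unfolding psd_on_def symmetric_on_def by blast
  ultimately show ?thesis using assms unfolding psd_on_def by simp
qed

text \<open>One step of symmetric Gaussian elimination removes a row and keeps the matrix psd.\<close>

lemma psd_on_decomposition:
  assumes "finite I" "psd_on I P"
  shows "\<exists>v. \<forall>a\<in>I. \<forall>b\<in>I. P a b = (\<Sum>k\<in>I. v k a * v k b)"
  using assms
proof (induction I arbitrary: P rule: finite_induct)
  case empty
  then show ?case by simp
next
  case (insert j I)
  note psd = insert.prems
  have fin: "finite (insert j I)" using insert.hyps by simp
  \<comment> \<open>\<open>Q\<close> is the Schur complement of the pivot \<open>P j j\<close>. For
    a zero pivot the convention \<open>x / 0 = 0\<close> makes \<open>u\<close> vanish, which is
    consistent because row \<open>j\<close> of \<open>P\<close> vanishes as well.\<close>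
  define u where "u a = P j a / sqrt (P j j)" for a
  define Q where "Q a b = P a b - u a * u b" for a b
  have Pjj: "P j j \<ge> 0" using psd_on_diag_nonneg[OF fin psd] by simp
  have row: "P j a = u j * u a" "P a j = u a * u j" if "a \<in> insert j I" for a
  proof -
    have s: "P a j = P j a"
      using psd that unfolding psd_on_def symmetric_on_def by (metis insertI1)
    have "P j a = u j * u a"
    proof (cases "P j j = 0")
      case True
      then show ?thesis using psd_on_zero_diag(1)[OF fin psd insertI1 that True] unfolding u_def by simp
    next
      case False
      have "u j * u a = P j j * P j a / (sqrt (P j j) * sqrt (P j j))" unfolding u_def by simp
      then show ?thesis using False Pjj by simp
    qed
    then show "P j a = u j * u a" "P a j = u a * u j" using s by simp_all
  qed
  have "psd_on (insert j I) Q"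
    unfolding psd_on_def
  proof (intro conjI allI)
    show "symmetric_on (insert j I) Q"
      using psd unfolding psd_on_def symmetric_on_def Q_def by (metis mult.commute)
    fix w
    define s where "s = (\<Sum>b\<in>insert j I. P j b * w b)"
    have Qw: "qform (insert j I) Q w = qform (insert j I) P w - (\<Sum>a\<in>insert j I. u a * w a)\<^sup>2"
      unfolding Q_def qform_eq_frob[of _ _ w] frob_diff_left
      by (simp add: qform_outer qform_eq_frob[symmetric])
    have us: "(\<Sum>a\<in>insert j I. u a * w a)\<^sup>2 = s\<^sup>2 / P j j"
    proof -
      have "(\<Sum>a\<in>insert j I. u a * w a) = s / sqrt (P j j)"
        unfolding s_def u_def sum_divide_distrib by (auto intro!: sum.cong)
      then show ?thesis using Pjj by (simp add: power_divide)
    qed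
    show "0 \<le> qform (insert j I) Q w"
    proof (cases "P j j = 0")
      case True
      then show ?thesis using Qw us psd unfolding psd_on_def by simp
    next
      case False
      \<comment> \<open>The shift \<open>- s / P j j\<close> of coordinate \<open>j\<close>
        minimises the form, and the minimum is the form of \<open>Q\<close>.\<close>
      have "0 \<le> qform (insert j I) P (\<lambda>a. w a + (if a = j then - s / P j j else 0))"
        using psd unfolding psd_on_def by blast
      also have "\<dots> = qform (insert j I) P w + 2 * (- s / P j j) * s + (- s / P j j)\<^sup>2 * P j j"
        using qform_shift_unit[OF fin, of j P w "- s / P j j"] psd
        unfolding s_def psd_on_def by simp
      also have "\<dots> = qform (insert j I) P w - s\<^sup>2 / P j j"
        using False by (simp add: field_simps power2_eq_square)
      finally show ?thesis using Qw us by simp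
    qed
  qed
  then have "psd_on I Q" by (rule psd_on_subset[OF fin, rotated]) auto
  then obtain v where v: "\<forall>a\<in>I. \<forall>b\<in>I. Q a b = (\<Sum>k\<in>I. v k a * v k b)"
    using insert.IH by blast
  \<comment> \<open>The index \<open>j\<close> labels the new rank one term; the vectors for the
    smaller matrix are extended by zero at \<open>j\<close>.\<close>
  define v' where "v' k = (if k = j then u else (v k)(j := 0))" for k
  have "P a b = (\<Sum>k\<in>insert j I. v' k a * v' k b)" if ab: "a \<in> insert j I" "b \<in> insert j I" for a b
  proof -
    have e: "(\<Sum>k\<in>insert j I. v' k a * v' k b) =
        u a * u b + (\<Sum>k\<in>I. ((v k)(j := 0)) a * ((v k)(j := 0)) b)"
      using insert.hyps unfolding v'_def by (auto intro!: sum.cong)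
    show ?thesis
    proof (cases "a = j \<or> b = j")
      case True
      then have "(\<Sum>k\<in>I. ((v k)(j := 0)) a * ((v k)(j := 0)) b) = 0"
        by (intro sum.neutral) auto
      then show ?thesis using True row ab e by auto
    next
      case False
      then have "Q a b = (\<Sum>k\<in>I. ((v k)(j := 0)) a * ((v k)(j := 0)) b)" using ab v by simp
      then show ?thesis using e unfolding Q_def by simp
    qed
  qed
  then show ?case by blast
qed

lemma frob_psd_decomposition:
  assumes "finite I" "psd_on I P"
  obtains v where "\<And>a b. a \<in> I \<Longrightarrow> b \<in> I \<Longrightarrow> P a b = (\<Sum>k\<in>I. v k a * v k b)"
    and "\<And>Q. frob I P Q = (\<Sum>k\<in>I. qform I Q (v k))"
proof -
  obtain v where v: "\<forall>a\<in>I. \<forall>b\<in>I. P a b = (\<Sum>k\<in>I. v k a * v k b)"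
    using psd_on_decomposition[OF assms] by blast
  moreover have "frob I P Q = (\<Sum>k\<in>I. qform I Q (v k))" for Q
  proof -
    have "frob I P Q = frob I (\<lambda>a b. \<Sum>k\<in>I. v k a * v k b) Q"
      using v by (intro frob_cong) auto
    then show ?thesis unfolding frob_sum_left qform_eq_frob by (simp add: frob_commute)
  qed
  ultimately show ?thesis using that by blast
qed

text \<open>One half of the self-duality of the psd cone: a Gram decomposition of \<open>P\<close>
  turns the product into a sum of values of the form of \<open>Q\<close>.\<close>

lemma frob_psd_nonneg:
  assumes "finite I" "psd_on I P" "psd_on I Q"
  shows "0 \<le> frob I P Q"
proof -
  obtain v where "frob I P Q = (\<Sum>k\<in>I. qform I Q (v k))"
    using frob_psd_decomposition[OF assms(1,2)] by metis
  then show ?thesis using assms(3) unfolding psd_on_def by (simp add: sum_nonneg)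
qed

text \<open>In the Gram decomposition of \<open>P\<close> the values of the form of \<open>Q\<close>
  are nonnegative with sum zero, and definiteness makes each Gram vector vanish.\<close>

lemma frob_psd_posdef_zero:
  assumes I: "finite I" and P: "psd_on I P" and Q: "posdef_on I Q" and zero: "frob I P Q = 0"
    and "a \<in> I" "b \<in> I"
  shows "P a b = 0"
proof -
  obtain v where v: "\<And>a b. a \<in> I \<Longrightarrow> b \<in> I \<Longrightarrow> P a b = (\<Sum>k\<in>I. v k a * v k b)"
    and fr: "\<And>Q. frob I P Q = (\<Sum>k\<in>I. qform I Q (v k))"
    using frob_psd_decomposition[OF I P] by metis
  have qz: "qform I Q w \<ge> 0" for w
  proof (cases "\<exists>a\<in>I. w a \<noteq> 0")
    case True
    then show ?thesis using Q unfolding posdef_on_def by (meson less_imp_le)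
  next
    case False
    then show ?thesis unfolding qform_def by simp
  qed
  have "qform I Q (v k) = 0" if "k \<in> I" for k
    using zero fr qz I that sum_nonneg_eq_0_iff[of I "\<lambda>k. qform I Q (v k)"] by auto
  then have "v k c = 0" if "k \<in> I" "c \<in> I" for k c
    using Q that unfolding posdef_on_def by (metis less_irrefl)
  then show ?thesis using v assms by simp
qed


section \<open>Duality and theorems of the alternative from separation\<close>

lemma psd_on_outer: "psd_on I (\<lambda>a b. v a * v b)"
  unfolding psd_on_def symmetric_on_def by (simp add: qform_outer mult.commute)

text \<open>Adding an arbitrary skew-symmetric part to \<open>P\<close> in the separated set forces the separating
  functional to be symmetric.\<close>

lemma slater_strong_duality:
  fixes F :: "'k \<Rightarrow> 'a \<Rightarrow> 'a \<Rightarrow> real"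
  assumes I: "finite I" and K: "finite K" and symF: "\<And>i. i \<in> K \<Longrightarrow> symmetric_on I (F i)"
    and ub: "\<And>x. psd_on I (\<lambda>a b. of_bool (a = b) - (\<Sum>i\<in>K. x i * F i a b)) \<Longrightarrow>
      (\<Sum>i\<in>K. c i * x i) \<le> v"
    and lub: "\<And>w. (\<And>x. psd_on I (\<lambda>a b. of_bool (a = b) - (\<Sum>i\<in>K. x i * F i a b)) \<Longrightarrow>
      (\<Sum>i\<in>K. c i * x i) \<le> w) \<Longrightarrow> v \<le> w"
  shows "\<exists>Y. psd_on I Y \<and> (\<forall>i\<in>K. frob I (F i) Y = c i) \<and> (\<Sum>a\<in>I. Y a a) = v"
proof -
  \<comment> \<open>Coordinate \<open>None\<close> vanishes if the objective exceeds
    \<open>v\<close> by \<open>q\<close>, the coordinates \<open>Some (a, b)\<close> if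
    \<open>P\<close> is the slack at \<open>x\<close>. With \<open>q > 0\<close> both together would
    contradict \<open>ub\<close>, so the origin is avoided.\<close>
  define g where "g x P q = (\<lambda>j. case j of
      None \<Rightarrow> v - (\<Sum>i\<in>K. c i * x i) + q
    | Some (a, b) \<Rightarrow> (\<Sum>i\<in>K. x i * F i a b) - of_bool (a = b) + P a b)"
    for x :: "'k \<Rightarrow> real" and P and q :: real
  define J where "J = insert None (Some ` (I \<times> I))"
  define C where "C = {g x P q | x P q. (\<forall>w. 0 \<le> qform I P w) \<and> q > 0}"
  have "\<exists>y. (\<exists>j\<in>J. y j \<noteq> 0) \<and> (\<forall>d\<in>C. 0 \<le> (\<Sum>j\<in>J. y j * d j))"
  proof (rule weak_separation_from_origin)
    show "finite J" unfolding J_def using I by simp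
    have "qform I (\<lambda>a b. 0) w = 0" for w unfolding qform_def by simp
    then have "g (\<lambda>_. 0) (\<lambda>_ _. 0) 1 \<in> C" unfolding C_def by fastforce
    then show "C \<noteq> {}" by blast
  next
    fix d d' and u :: real
    assume "d \<in> C" "d' \<in> C" and u: "0 \<le> u" "u \<le> 1"
    then obtain x P q x' P' q' where d: "d = g x P q" "d' = g x' P' q'"
      and P: "\<And>w. 0 \<le> qform I P w" "\<And>w. 0 \<le> qform I P' w" and q: "q > 0" "q' > 0"
      unfolding C_def by blast
    let ?x = "\<lambda>i. u * x i + (1 - u) * x' i"
    let ?P = "\<lambda>a b. u * P a b + (1 - u) * P' a b"
    let ?q = "u * q + (1 - u) * q'"
    have "(\<lambda>j. u * d j + (1 - u) * d' j) = g ?x ?P ?q"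
    proof
      fix j
      have e: "(\<Sum>i\<in>K. f i * ?x i) = u * (\<Sum>i\<in>K. f i * x i) + (1 - u) * (\<Sum>i\<in>K. f i * x' i)" for f
        unfolding sum_distrib_left sum.distrib[symmetric] by (auto intro!: sum.cong simp: algebra_simps)
      show "u * d j + (1 - u) * d' j = g ?x ?P ?q j"
      proof (cases j)
        case None
        then show ?thesis unfolding d g_def by (simp add: e) (simp add: algebra_simps)
      next
        case (Some ab)
        obtain a b where ab: "ab = (a, b)" by fastforce
        have "(\<Sum>i\<in>K. ?x i * F i a b) =
            u * (\<Sum>i\<in>K. x i * F i a b) + (1 - u) * (\<Sum>i\<in>K. x' i * F i a b)"
          using e[of "\<lambda>i. F i a b"] by (simp add: mult.commute)
        then show ?thesis unfolding d g_def Some ab by (simp) (simp add: algebra_simps)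
      qed
    qed
    moreover have "0 \<le> qform I ?P w" for w
      using P[of w] u unfolding qform_eq_frob frob_add_left frob_scale_left by simp
    moreover have "?q > 0"
    proof (cases "u = 0")
      case False
      then show ?thesis using u q by (intro add_pos_nonneg) auto
    qed (use q in simp)
    ultimately show "(\<lambda>j. u * d j + (1 - u) * d' j) \<in> C"
      unfolding C_def by blast
  next
    fix d assume "d \<in> C"
    then obtain x P q where d: "d = g x P q" and P: "\<And>w. 0 \<le> qform I P w" and q: "q > 0"
      unfolding C_def by blast
    show "\<exists>j\<in>J. d j \<noteq> 0"
    proof (rule ccontr)
      assume "\<not> (\<exists>j\<in>J. d j \<noteq> 0)"
      then have z: "d None = 0" "\<And>a b. a \<in> I \<Longrightarrow> b \<in> I \<Longrightarrow> d (Some (a, b)) = 0"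
        unfolding J_def by auto
      have e: "P a b = of_bool (a = b) - (\<Sum>i\<in>K. x i * F i a b)" if "a \<in> I" "b \<in> I" for a b
        using z(2)[OF that] unfolding d g_def by simp
      have "symmetric_on I (\<lambda>a b. of_bool (a = b) - (\<Sum>i\<in>K. x i * F i a b))"
        by (intro symmetric_on_diff symmetric_on_comb symF) (auto simp: symmetric_on_def)
      moreover have "0 \<le> qform I (\<lambda>a b. of_bool (a = b) - (\<Sum>i\<in>K. x i * F i a b)) w" for w
      proof -
        have "qform I P w = qform I (\<lambda>a b. of_bool (a = b) - (\<Sum>i\<in>K. x i * F i a b)) w"
          by (rule qform_cong) (simp_all add: e)
        then show ?thesis using P[of w] by simp
      qed
      ultimately have "psd_on I (\<lambda>a b. of_bool (a = b) - (\<Sum>i\<in>K. x i * F i a b))"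
        unfolding psd_on_def by blast
      from ub[OF this] show False using z(1) q unfolding d g_def by simp
    qed
  qed
  then obtain y where y: "\<exists>j\<in>J. y j \<noteq> 0" "\<And>d. d \<in> C \<Longrightarrow> 0 \<le> (\<Sum>j\<in>J. y j * d j)"
    by blast
  \<comment> \<open>\<open>s\<close> is the multiplier of the objective and \<open>Y\<close> that of
    the matrix constraint; the dual solution will be \<open>Y\<close> divided by
    \<open>s\<close>.\<close>
  define Y where "Y a b = y (Some (a, b))" for a b
  define s where "s = y None"
  have sumJ: "(\<Sum>j\<in>J. y j * d j) = s * d None + frob I Y (\<lambda>a b. d (Some (a, b)))" for d
  proof -
    have "(\<Sum>j\<in>Some ` (I \<times> I). y j * d j) = frob I Y (\<lambda>a b. d (Some (a, b)))"
      unfolding frob_def Y_def by (simp add: sum.reindex sum.cartesian_product case_prod_unfold)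
    then show ?thesis unfolding J_def s_def using I by (subst sum.insert) auto
  qed
  have frY: "frob I Y (\<lambda>a b. (\<Sum>i\<in>K. x i * F i a b) - of_bool (a = b) + P a b) =
      (\<Sum>i\<in>K. x i * frob I (F i) Y) - (\<Sum>a\<in>I. Y a a) + frob I P Y" for x P
    by (subst frob_commute)
      (simp only: frob_add_left frob_diff_left frob_comb_left frob_kronecker[OF I])
  have main: "0 \<le> s * (v - (\<Sum>i\<in>K. c i * x i) + q) +
      ((\<Sum>i\<in>K. x i * frob I (F i) Y) - (\<Sum>a\<in>I. Y a a) + frob I P Y)"
    if "\<And>w. 0 \<le> qform I P w" "q > 0" for x P q
  proof -
    have "g x P q \<in> C" unfolding C_def using that by blast
    from y(2)[OF this] show ?thesis unfolding sumJ frY[symmetric] unfolding g_def by simp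
  qed
  have main0: "0 \<le> s * (v + 1) - (\<Sum>a\<in>I. Y a a) + frob I P Y"
    if "\<And>w. 0 \<le> qform I P w" for P
    using main[OF that, of 1 "\<lambda>_. 0"] by simp
  have q0: "0 \<le> qform I (\<lambda>_ _. 0) w" for w unfolding qform_def by simp
  have fr0: "frob I (\<lambda>_ _. 0) Y = 0" unfolding frob_def by simp
  have symY: "symmetric_on I Y"
    unfolding symmetric_on_def
  proof (intro ballI)
    fix a b assume ab: "a \<in> I" "b \<in> I"
    \<comment> \<open>An elementary skew-symmetric matrix: its quadratic form is zero, so every real
      multiple of it may serve as \<open>P\<close>.\<close>
    define N :: "'a \<Rightarrow> 'a \<Rightarrow> real" where "N p q = of_bool (p = a \<and> q = b) - of_bool (p = b \<and> q = a)" for p q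
    have d: "(\<Sum>p\<in>I. \<Sum>q\<in>I. of_bool (p = a' \<and> q = b') * h p q) = h a' b'"
      if "a' \<in> I" "b' \<in> I" for h :: "'a \<Rightarrow> 'a \<Rightarrow> real" and a' b'
    proof -
      have "(\<Sum>q\<in>I. of_bool (p = a' \<and> q = b') * h p q) = (if p = a' then h a' b' else 0)" for p
        using I that by (simp add: of_bool_def if_distrib[of "\<lambda>x. x * _"] cong: if_cong)
      then show ?thesis using I that by simp
    qed
    have fN: "frob I N h = h a b - h b a" for h
      unfolding N_def frob_diff_left using d ab by (simp add: frob_def)
    have "Y a b - Y b a = 0"
    proof (rule slope_zero)
      fix t :: real
      have "qform I (\<lambda>p q. t * N p q) w = 0" for w
        unfolding qform_eq_frob frob_scale_left fN by simp
      then show "0 \<le> (s * (v + 1) - (\<Sum>a\<in>I. Y a a)) + t * (Y a b - Y b a)"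
        using main0[of "\<lambda>p q. t * N p q"] unfolding frob_scale_left fN by simp
    qed
    then show "Y a b = Y b a" by simp
  qed
  have "0 \<le> qform I Y w" for w
  proof (rule slope_nonneg)
    fix t :: real assume "t > 0"
    then have "0 \<le> qform I (\<lambda>a b. t * (w a * w b)) w'" for w'
      unfolding qform_eq_frob frob_scale_left unfolding qform_eq_frob[symmetric] qform_outer by simp
    from main0[OF this] show "0 \<le> (s * (v + 1) - (\<Sum>a\<in>I. Y a a)) + t * qform I Y w"
      unfolding frob_scale_left qform_eq_frob by (simp add: frob_commute)
  qed
  then have psdY: "psd_on I Y" using symY unfolding psd_on_def by blast
  have s: "0 \<le> s"
  proof (rule slope_nonneg)
    fix t :: real assume "t > 0"
    from main[OF q0 this, of "\<lambda>_. 0"] show "0 \<le> (s * v - (\<Sum>a\<in>I. Y a a)) + t * s"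
      unfolding fr0 by (simp add: algebra_simps)
  qed
  have "0 \<le> s * v - (\<Sum>a\<in>I. Y a a)"
  proof (rule intercept_nonneg)
    fix t :: real assume "t > 0"
    from main[OF q0 this, of "\<lambda>_. 0"] show "0 \<le> (s * v - (\<Sum>a\<in>I. Y a a)) + t * s"
      unfolding fr0 by (simp add: algebra_simps)
  qed
  then have trY: "(\<Sum>a\<in>I. Y a a) \<le> s * v" by simp
  have FY: "frob I (F i) Y = s * c i" if i: "i \<in> K" for i
  proof -
    have "frob I (F i) Y - s * c i = 0"
    proof (rule slope_zero)
      fix t :: real
      have d: "(\<Sum>k\<in>K. (if k = i then t else 0) * h k) = t * h i"
        "(\<Sum>k\<in>K. h k * (if k = i then t else 0)) = t * h i" for h :: "'k \<Rightarrow> real"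
        using K i by (simp_all add: if_distrib[of "\<lambda>x. x * _"] if_distrib[of "\<lambda>x. _ * x"] cong: if_cong)
      show "0 \<le> (s * (v + 1) - (\<Sum>a\<in>I. Y a a)) + t * (frob I (F i) Y - s * c i)"
        using main[OF q0, of 1 "\<lambda>k. if k = i then t else 0"] unfolding fr0 d
        by (simp add: algebra_simps)
    qed
    then show ?thesis by simp
  qed
  \<comment> \<open>Slater's condition enters here. The point \<open>x = 0\<close> with slack the
    identity gave \<open>trY\<close>; with \<open>s = 0\<close> the psd matrix \<open>Y\<close>
    would have trace zero, hence vanish, and the functional would be trivial.\<close>
  have "s > 0"
  proof (rule ccontr)
    assume "\<not> s > 0"
    then have s0: "s = 0" using s by simp
    have nn: "0 \<le> Y a a" if "a \<in> I" for a using psd_on_diag_nonneg[OF I psdY that] .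
    then have "(\<Sum>a\<in>I. Y a a) = 0" using trY s0 by (simp add: sum_nonneg antisym)
    then have "Y a a = 0" if "a \<in> I" for a
      using nn that sum_nonneg_eq_0_iff[OF I, of "\<lambda>a. Y a a"] by auto
    then have "Y a b = 0" if "a \<in> I" "b \<in> I" for a b
      using psd_on_zero_diag(1)[OF I psdY that] that by blast
    then show False using y(1) s0 unfolding J_def Y_def s_def by auto
  qed
  define W where "W a b = (1 / s) * Y a b" for a b
  have "psd_on I W"
    using psdY \<open>s > 0\<close> unfolding psd_on_def symmetric_on_def W_def qform_eq_frob frob_scale_left
    by simp
  moreover have FW: "frob I (F i) W = c i" if "i \<in> K" for i
    using FY[OF that] \<open>s > 0\<close> unfolding W_def frob_commute[of I "F i"] frob_scale_left
    by simp
  moreover have "(\<Sum>a\<in>I. W a a) = v"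
  proof (rule antisym)
    have "(\<Sum>a\<in>I. W a a) = (\<Sum>a\<in>I. Y a a) / s" unfolding W_def sum_divide_distrib by simp
    then show "(\<Sum>a\<in>I. W a a) \<le> v" using trY \<open>s > 0\<close> by (simp add: divide_le_eq mult.commute)
    \<comment> \<open>Weak duality: the trace of \<open>W\<close> bounds the objective at every
      feasible point, hence also the least such bound \<open>v\<close>.\<close>
    show "v \<le> (\<Sum>a\<in>I. W a a)"
    proof (rule lub)
      fix x assume "psd_on I (\<lambda>a b. of_bool (a = b) - (\<Sum>i\<in>K. x i * F i a b))"
      from frob_psd_nonneg[OF I this \<open>psd_on I W\<close>]
      have "0 \<le> (\<Sum>a\<in>I. W a a) - (\<Sum>i\<in>K. x i * frob I (F i) W)"
        unfolding frob_diff_left frob_comb_left frob_kronecker[OF I] .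
      moreover have "(\<Sum>i\<in>K. x i * frob I (F i) W) = (\<Sum>i\<in>K. c i * x i)"
        by (intro sum.cong) (simp_all add: FW)
      ultimately show "(\<Sum>i\<in>K. c i * x i) \<le> (\<Sum>a\<in>I. W a a)" by simp
    qed
  qed
  ultimately show ?thesis by blast
qed

text \<open>A semidefinite analogue of the alternative theorems of Gordan and Stiemke. If no such
  \<open>U\<close> exists, the image of the definite cone under the products with the
  \<open>H i\<close> is convex and avoids the origin; a separating vector \<open>x\<close> makes the
  combination of the \<open>H i\<close> psd although \<open>x\<close> is nontrivial.\<close>

lemma posdef_orthogonal_exists:
  fixes H :: "'k \<Rightarrow> 'a \<Rightarrow> 'a \<Rightarrow> real"
  assumes I: "finite I" and K: "finite K" and symH: "\<And>i. i \<in> K \<Longrightarrow> symmetric_on I (H i)"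
    and only0: "\<And>x. psd_on I (\<lambda>a b. \<Sum>i\<in>K. x i * H i a b) \<Longrightarrow> \<forall>i\<in>K. x i = 0"
  shows "\<exists>U. posdef_on I U \<and> (\<forall>i\<in>K. frob I (H i) U = 0)"
proof (rule ccontr)
  assume no: "\<not> ?thesis"
  define C where "C = {(\<lambda>i. frob I (H i) U) | U. posdef_on I U}"
  have CI: "(\<lambda>i. frob I (H i) U) \<in> C" if "posdef_on I U" for U
    using that unfolding C_def by blast
  \<comment> \<open>Rank one matrices are not definite in general, so they are perturbed by
    \<open>e\<close> times the identity; \<open>intercept_nonneg\<close> later removes
    \<open>e\<close>.\<close>
  have pd: "posdef_on I (\<lambda>a b. of_bool (a = b) * e + w a * w b)" if "e > 0" for e and w :: "'a \<Rightarrow> real"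
    unfolding posdef_on_def
  proof (intro conjI allI impI)
    show "symmetric_on I (\<lambda>a b. of_bool (a = b) * e + w a * w b)" unfolding symmetric_on_def by auto
    fix u assume "\<exists>a\<in>I. u a \<noteq> (0 :: real)"
    then have "0 < (\<Sum>a\<in>I. (u a)\<^sup>2)" using I by (auto intro!: sum_pos2)
    moreover have "qform I (\<lambda>a b. of_bool (a = b) * e + w a * w b) u =
        e * (\<Sum>a\<in>I. (u a)\<^sup>2) + (\<Sum>a\<in>I. w a * u a)\<^sup>2"
      unfolding qform_eq_frob mult.commute[of "of_bool _" e] frob_add_left frob_scale_left
      unfolding qform_eq_frob[symmetric] qform_kronecker[OF I] qform_outer ..
    ultimately show "0 < qform I (\<lambda>a b. of_bool (a = b) * e + w a * w b) u"
      using that by (simp add: add_pos_nonneg)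
  qed
  have "\<exists>x. (\<exists>i\<in>K. x i \<noteq> 0) \<and> (\<forall>d\<in>C. 0 \<le> (\<Sum>i\<in>K. x i * d i))"
  proof (rule weak_separation_from_origin[OF K])
    show "C \<noteq> {}" using CI[OF pd[of 1 "\<lambda>_. 0"]] by auto
    show "\<exists>i\<in>K. d i \<noteq> 0" if "d \<in> C" for d using no that unfolding C_def by blast
  next
    fix d d' and u :: real
    assume "d \<in> C" "d' \<in> C" and u: "0 \<le> u" "u \<le> 1"
    then obtain U U' where d: "d = (\<lambda>i. frob I (H i) U)" "d' = (\<lambda>i. frob I (H i) U')"
      and U: "posdef_on I U" "posdef_on I U'" unfolding C_def by blast
    let ?U = "\<lambda>a b. u * U a b + (1 - u) * U' a b"
    have "posdef_on I ?U"
      unfolding posdef_on_def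
    proof (intro conjI allI impI)
      show "symmetric_on I ?U" using U unfolding posdef_on_def symmetric_on_def by simp
      fix w assume "\<exists>a\<in>I. w a \<noteq> (0 :: real)"
      then have "0 < qform I U w" "0 < qform I U' w" using U unfolding posdef_on_def by auto
      moreover have "qform I ?U w = u * qform I U w + (1 - u) * qform I U' w"
        unfolding qform_eq_frob frob_add_left frob_scale_left ..
      ultimately show "0 < qform I ?U w"
        using u by (cases "u = 0") (auto intro: add_pos_nonneg)
    qed
    moreover have "(\<lambda>i. u * d i + (1 - u) * d' i) = (\<lambda>i. frob I (H i) ?U)"
      unfolding d frob_commute[of I "H _"] frob_add_left frob_scale_left ..
    ultimately show "(\<lambda>i. u * d i + (1 - u) * d' i) \<in> C" using CI by simp
  qed
  then obtain x where x: "\<exists>i\<in>K. x i \<noteq> 0" "\<And>d. d \<in> C \<Longrightarrow> 0 \<le> (\<Sum>i\<in>K. x i * d i)"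
    by blast
  let ?S = "\<lambda>a b. \<Sum>i\<in>K. x i * H i a b"
  have "0 \<le> qform I ?S w" for w
  proof (rule intercept_nonneg)
    fix e :: real assume "e > 0"
    then have "(\<lambda>i. frob I (H i) (\<lambda>a b. of_bool (a = b) * e + w a * w b)) \<in> C"
      by (intro CI pd)
    from x(2)[OF this] have "0 \<le> frob I ?S (\<lambda>a b. of_bool (a = b) * e + w a * w b)"
      unfolding frob_comb_left .
    also have "\<dots> = qform I ?S w + e * (\<Sum>a\<in>I. ?S a a)"
      unfolding frob_commute[of I ?S] mult.commute[of "of_bool _" e] frob_add_left frob_scale_left
        frob_kronecker[OF I] qform_eq_frob by (simp add: frob_commute)
    finally show "0 \<le> qform I ?S w + e * (\<Sum>a\<in>I. ?S a a)" .
  qed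
  then have "psd_on I ?S" using symmetric_on_comb[of K I H x] symH unfolding psd_on_def by blast
  then show False using only0 x(1) by blast
qed

text \<open>If \<open>d\<close> is not attained, a vector separating it from the image of the psd
  cone gives a psd combination of the \<open>H i\<close>. This combination is orthogonal to the
  definite matrix \<open>U\<close>, hence zero, against independence.\<close>

lemma psd_with_prescribed_products:
  fixes H :: "'k \<Rightarrow> 'a \<Rightarrow> 'a \<Rightarrow> real"
  assumes I: "finite I" and K: "finite K" and symH: "\<And>i. i \<in> K \<Longrightarrow> symmetric_on I (H i)"
    and indep: "\<And>x. (\<And>a b. a \<in> I \<Longrightarrow> b \<in> I \<Longrightarrow> (\<Sum>i\<in>K. x i * H i a b) = 0) \<Longrightarrow> \<forall>i\<in>K. x i = 0"
    and U: "posdef_on I U" and HU: "\<And>i. i \<in> K \<Longrightarrow> frob I (H i) U = 0"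
  shows "\<exists>Y. psd_on I Y \<and> (\<forall>i\<in>K. frob I (H i) Y = d i)"
proof (rule ccontr)
  assume no: "\<not> ?thesis"
  define C where "C = {(\<lambda>i. frob I (H i) Y - d i) | Y. psd_on I Y}"
  have "\<exists>x. (\<exists>i\<in>K. x i \<noteq> 0) \<and> (\<forall>f\<in>C. 0 \<le> (\<Sum>i\<in>K. x i * f i))"
  proof (rule weak_separation_from_origin[OF K])
    show "C \<noteq> {}" unfolding C_def using psd_on_outer by blast
    show "\<exists>i\<in>K. f i \<noteq> 0" if "f \<in> C" for f using no that unfolding C_def by force
  next
    fix f f' and u :: real
    assume "f \<in> C" "f' \<in> C" and u: "0 \<le> u" "u \<le> 1"
    then obtain Y Y' where f: "f = (\<lambda>i. frob I (H i) Y - d i)" "f' = (\<lambda>i. frob I (H i) Y' - d i)"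
      and Y: "psd_on I Y" "psd_on I Y'" unfolding C_def by blast
    let ?Y = "\<lambda>a b. u * Y a b + (1 - u) * Y' a b"
    have "psd_on I ?Y"
      using Y u unfolding psd_on_def symmetric_on_def qform_eq_frob frob_add_left frob_scale_left by simp
    moreover have "(\<lambda>i. u * f i + (1 - u) * f' i) = (\<lambda>i. frob I (H i) ?Y - d i)"
      unfolding f frob_commute[of I "H _"] frob_add_left frob_scale_left
      by (simp add: algebra_simps)
    ultimately show "(\<lambda>i. u * f i + (1 - u) * f' i) \<in> C" unfolding C_def by blast
  qed
  then obtain x where x: "\<exists>i\<in>K. x i \<noteq> 0" "\<And>f. f \<in> C \<Longrightarrow> 0 \<le> (\<Sum>i\<in>K. x i * f i)"
    by blast
  let ?S = "\<lambda>a b. \<Sum>i\<in>K. x i * H i a b"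
  have "0 \<le> qform I ?S w" for w
  \<comment> \<open>The cone is closed under scaling by \<open>t\<close>, so the constant offset
    coming from \<open>d\<close> cannot affect the sign.\<close>
  proof (rule slope_nonneg)
    fix t :: real assume t: "t > 0"
    have "psd_on I (\<lambda>a b. t * (w a * w b))"
      using psd_on_outer[of I w] t unfolding psd_on_def symmetric_on_def qform_eq_frob frob_scale_left
      by simp
    then have "(\<lambda>i. frob I (H i) (\<lambda>a b. t * (w a * w b)) - d i) \<in> C"
      unfolding C_def by blast
    from x(2)[OF this] have "0 \<le> frob I ?S (\<lambda>a b. t * (w a * w b)) - (\<Sum>i\<in>K. x i * d i)"
      unfolding frob_comb_left by (simp add: right_diff_distrib sum_subtractf)
    also have "frob I ?S (\<lambda>a b. t * (w a * w b)) = t * qform I ?S w"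
      unfolding frob_commute[of I ?S] frob_scale_left qform_eq_frob ..
    finally show "0 \<le> - (\<Sum>i\<in>K. x i * d i) + t * qform I ?S w" by simp
  qed
  then have "psd_on I ?S" using symmetric_on_comb[of K I H x] symH unfolding psd_on_def by blast
  moreover have "frob I ?S U = 0" unfolding frob_comb_left using HU by simp
  ultimately have "?S a b = 0" if "a \<in> I" "b \<in> I" for a b
    using frob_psd_posdef_zero[OF I _ U] that by blast
  then show False using indep x(1) by blast
qed

section \<open>Matrices and maximum rank slacks\<close>

abbreviation ent :: "real mat \<Rightarrow> nat \<Rightarrow> nat \<Rightarrow> real" where
  "ent S \<equiv> \<lambda>a b. S $$ (a, b)"

lemma sym_mat_iff: "sym_mat n S \<longleftrightarrow> S \<in> carrier_mat n n \<and> symmetric_on {..<n} (ent S)"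
proof
  assume S: "sym_mat n S"
  then have "S $$ (a, b) = S $$ (b, a)" if "a < n" "b < n" for a b
    using that index_transpose_mat(1)[of b S a] unfolding sym_mat_def by auto
  then show "S \<in> carrier_mat n n \<and> symmetric_on {..<n} (ent S)"
    using S unfolding sym_mat_def symmetric_on_def by simp
next
  assume "S \<in> carrier_mat n n \<and> symmetric_on {..<n} (ent S)"
  then show "sym_mat n S" unfolding sym_mat_def symmetric_on_def by (auto intro!: eq_matI)
qed

lemma mat_inner_eq_sum:
  assumes "S \<in> carrier_mat n n" "T \<in> carrier_mat n n"
  shows "mat_inner S T = (\<Sum>a<n. \<Sum>b<n. S $$ (a, b) * T $$ (b, a))"
  using assms unfolding mat_inner_def mat_trace_def
  by (auto intro!: sum.cong simp: scalar_prod_def lessThan_atLeast0)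

lemma mat_inner_eq_frob:
  assumes "S \<in> carrier_mat n n" "sym_mat n T"
  shows "mat_inner S T = frob {..<n} (ent S) (ent T)"
  using assms mat_inner_eq_sum[of S n T] unfolding sym_mat_iff symmetric_on_def frob_def
  by (auto intro!: sum.cong)

lemma scalar_prod_mult_mat_vec_eq_qform:
  assumes "S \<in> carrier_mat n n" "v \<in> carrier_vec n"
  shows "v \<bullet> (S *\<^sub>v v) = qform {..<n} (ent S) (($) v)"
  using assms unfolding qform_def
  by (auto intro!: sum.cong simp: scalar_prod_def sum_distrib_left lessThan_atLeast0 algebra_simps)

lemma psd_iff: "psd n S \<longleftrightarrow> S \<in> carrier_mat n n \<and> psd_on {..<n} (ent S)"
proof -
  have "(\<forall>v\<in>carrier_vec n. 0 \<le> v \<bullet> (S *\<^sub>v v)) \<longleftrightarrow> (\<forall>w. 0 \<le> qform {..<n} (ent S) w)"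
    if S: "S \<in> carrier_mat n n"
  proof (intro iffI allI ballI)
    fix w assume *: "\<forall>v\<in>carrier_vec n. 0 \<le> v \<bullet> (S *\<^sub>v v)"
    have "qform {..<n} (ent S) w = qform {..<n} (ent S) (($) (vec n w))"
      by (rule qform_cong) auto
    also have "\<dots> \<ge> 0"
      using * scalar_prod_mult_mat_vec_eq_qform[OF S, of "vec n w"] by (metis vec_carrier)
    finally show "0 \<le> qform {..<n} (ent S) w" .
  qed (simp add: scalar_prod_mult_mat_vec_eq_qform[OF S])
  then show ?thesis unfolding psd_def psd_on_def sym_mat_iff by blast
qed

lemma posdef_iff: "posdef n S \<longleftrightarrow> S \<in> carrier_mat n n \<and> posdef_on {..<n} (ent S)"
proof -
  have "(\<forall>v\<in>carrier_vec n. v \<noteq> 0\<^sub>v n \<longrightarrow> 0 < v \<bullet> (S *\<^sub>v v)) \<longleftrightarrow>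
      (\<forall>w. (\<exists>a\<in>{..<n}. w a \<noteq> 0) \<longrightarrow> 0 < qform {..<n} (ent S) w)"
    if S: "S \<in> carrier_mat n n"
  proof (intro iffI allI ballI impI)
    fix w :: "nat \<Rightarrow> real"
    assume *: "\<forall>v\<in>carrier_vec n. v \<noteq> 0\<^sub>v n \<longrightarrow> 0 < v \<bullet> (S *\<^sub>v v)"
      and w: "\<exists>a\<in>{..<n}. w a \<noteq> 0"
    have "vec n w \<noteq> 0\<^sub>v n"
    proof
      assume e: "vec n w = 0\<^sub>v n"
      have "w a = 0" if "a < n" for a using arg_cong[OF e, of "\<lambda>v. v $ a"] that by simp
      then show False using w by auto
    qed
    then have "0 < qform {..<n} (ent S) (($) (vec n w))"
      using * scalar_prod_mult_mat_vec_eq_qform[OF S, of "vec n w"] by (metis vec_carrier)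
    also have "qform {..<n} (ent S) (($) (vec n w)) = qform {..<n} (ent S) w"
      by (rule qform_cong) auto
    finally show "0 < qform {..<n} (ent S) w" .
  next
    fix v :: "real vec"
    assume *: "\<forall>w. (\<exists>a\<in>{..<n}. w a \<noteq> 0) \<longrightarrow> 0 < qform {..<n} (ent S) w"
      and v: "v \<in> carrier_vec n" "v \<noteq> 0\<^sub>v n"
    have "\<exists>a\<in>{..<n}. v $ a \<noteq> 0"
    proof (rule ccontr)
      assume "\<not> ?thesis"
      then have "v = 0\<^sub>v n" using v(1) by (intro eq_vecI) auto
      then show False using v(2) by simp
    qed
    then show "0 < v \<bullet> (S *\<^sub>v v)" using * scalar_prod_mult_mat_vec_eq_qform[OF S v(1)] by simp
  qed
  then show ?thesis unfolding posdef_def posdef_on_def sym_mat_iff by blast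
qed

lemma mat_lincomb_carrier [simp]: "mat_lincomb p q I x A \<in> carrier_mat p q"
  unfolding mat_lincomb_def by simp

lemma mat_lincomb_dim [simp]:
  "dim_row (mat_lincomb p q I x A) = p" "dim_col (mat_lincomb p q I x A) = q"
  unfolding mat_lincomb_def by simp_all

lemma mat_lincomb_index [simp]:
  "a < p \<Longrightarrow> b < q \<Longrightarrow> mat_lincomb p q I x A $$ (a, b) = (\<Sum>i\<in>I. x i * A i $$ (a, b))"
  unfolding mat_lincomb_def by simp

lemma mat_lin_indepD:
  assumes "mat_lin_indep p q I A"
    and "\<And>a b. a < p \<Longrightarrow> b < q \<Longrightarrow> (\<Sum>i\<in>I. x i * A i $$ (a, b)) = 0"
  shows "\<forall>i\<in>I. x i = 0"
proof -
  have "mat_lincomb p q I x A = 0\<^sub>m p q" using assms(2) by (intro eq_matI) auto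
  then show ?thesis using assms(1) unfolding mat_lin_indep_def by blast
qed

lemma mat_lin_indepI:
  assumes "\<And>x. (\<And>a b. a < p \<Longrightarrow> b < q \<Longrightarrow> (\<Sum>i\<in>I. x i * A i $$ (a, b)) = 0) \<Longrightarrow> \<forall>i\<in>I. x i = 0"
  shows "mat_lin_indep p q I A"
  unfolding mat_lin_indep_def
proof (intro allI impI)
  fix x assume e: "mat_lincomb p q I x A = 0\<^sub>m p q"
  show "\<forall>i\<in>I. x i = 0"
  proof (rule assms)
    fix a b assume "a < p" "b < q"
    then show "(\<Sum>i\<in>I. x i * A i $$ (a, b)) = 0"
      using arg_cong[OF e, of "\<lambda>S. S $$ (a, b)"] by simp
  qed
qed

lemma block_Z_carrier: "r \<le> n \<Longrightarrow> block_Z n r \<in> carrier_mat n n"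
  unfolding block_Z_def using four_block_carrier_mat[of "1\<^sub>m r" r r "0\<^sub>m (n - r) (n - r)" "n - r" "n - r"]
  by simp

lemma block_Z_index:
  assumes "r \<le> n" "a < n" "b < n"
  shows "block_Z n r $$ (a, b) = of_bool (a = b \<and> a < r)"
  using assms unfolding block_Z_def by auto

lemma sd_feasible_point_iff:
  assumes "B \<in> carrier_mat n n"
  shows "sd_feasible_point n m A B x \<longleftrightarrow>
    psd_on {..<n} (\<lambda>a b. B $$ (a, b) - (\<Sum>i=1..m. x i * A i $$ (a, b)))"
proof -
  have "psd_on {..<n} (ent (B - mat_lincomb n n {1..m} x A)) \<longleftrightarrow>
      psd_on {..<n} (\<lambda>a b. B $$ (a, b) - (\<Sum>i=1..m. x i * A i $$ (a, b)))"
    using assms by (intro psd_on_cong) auto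
  then show ?thesis
    using assms unfolding sd_feasible_point_def loewner_le_def psd_iff by auto
qed

lemma is_slack_iff:
  "is_slack n m A B S \<longleftrightarrow>
    (\<exists>x. sd_feasible_point n m A B x \<and> S = B - mat_lincomb n n {1..m} x A)"
  unfolding is_slack_def sd_feasible_point_def loewner_le_def by auto

section \<open>Rank bounds and the support of slacks\<close>

lemma rank_block_Z_le:
  assumes "r \<le> n"
  shows "vec_space.rank n (block_Z n r) \<le> r"
proof -
  interpret vec_space "TYPE(real)" n .
  have Z: "block_Z n r \<in> carrier_mat n n" using block_Z_carrier assms .
  obtain S where S: "maximal S (\<lambda>T. T \<subseteq> set (cols (block_Z n r)) \<and> lin_indpt T)"
    using maximal_exists[of "(\<lambda>T. T \<subseteq> set (cols (block_Z n r)) \<and> lin_indpt T)"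
        "card (set (cols (block_Z n r)))" "{}"]
    by (meson List.finite_set card_mono empty_iff empty_subsetI finite_lin_indpt2 rev_finite_subset)
  then have sub: "S \<subseteq> set (cols (block_Z n r))" and li: "lin_indpt S" unfolding maximal_def by auto
  have "S \<subseteq> carrier_vec n" using sub Z cols_dim[of "block_Z n r"] by auto
  \<comment> \<open>An independent set of columns cannot contain the zero vector, which leaves only
    the first \<open>r\<close> columns.\<close>
  then have nz: "0\<^sub>v n \<notin> S" using zero_nin_lin_indpt[OF _ li] class_semiring.one_zeroI by auto
  have "S \<subseteq> col (block_Z n r) ` {..<r}"
  proof
    fix u assume u: "u \<in> S"
    then obtain j where j: "j < n" "u = col (block_Z n r) j"
      using sub Z by (auto simp: cols_def)
    have "j < r"
    proof (rule ccontr)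
      assume "\<not> j < r"
      then have "u = 0\<^sub>v n"
        using j Z assms by (intro eq_vecI) (auto simp: block_Z_index)
      then show False using u nz by simp
    qed
    then show "u \<in> col (block_Z n r) ` {..<r}" using j by auto
  qed
  then have "card S \<le> card {..<r}" by (rule surj_card_le[rotated]) simp
  then show ?thesis using rank_card_indpt[OF Z S] by simp
qed

text \<open>A linear relation among the columns indexed by \<open>K\<close>, paired with its own
  coefficients, is a zero of the form on \<open>K\<close>. Hence these columns are
  independent.\<close>

lemma card_le_rank_if_definite:
  assumes M: "M \<in> carrier_mat n n" and K: "K \<subseteq> {..<n}"
    and def: "\<And>w. qform K (ent M) w = 0 \<Longrightarrow> \<forall>a\<in>K. w a = 0"
  shows "card K \<le> vec_space.rank n M"
proof -
  interpret vec_space "TYPE(real)" n .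
  have fin: "finite K" using K finite_subset by blast
  have lt: "p < n" if "p \<in> K" for p using K that by auto
  have ker: "\<forall>a\<in>K. w a = 0" if "\<And>p. p \<in> K \<Longrightarrow> (\<Sum>q\<in>K. w q * M $$ (p, q)) = 0" for w
  proof (rule def)
    have "qform K (ent M) w = (\<Sum>p\<in>K. w p * (\<Sum>q\<in>K. w q * M $$ (p, q)))"
      unfolding qform_def sum_distrib_left by (auto intro!: sum.cong simp: algebra_simps)
    then show "qform K (ent M) w = 0" using that by simp
  qed
  \<comment> \<open>\<open>lin_indpt\<close> speaks of a set of vectors, so equal columns must be
    excluded separately to keep the count at \<open>card K\<close>.\<close>
  have inj: "inj_on (col M) K"
  proof (rule inj_onI, rule ccontr)
    fix i j assume ij: "i \<in> K" "j \<in> K" "col M i = col M j" "i \<noteq> j"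
    define w :: "nat \<Rightarrow> real" where "w q = of_bool (q = i) - of_bool (q = j)" for q
    have "(\<Sum>q\<in>K. w q * M $$ (p, q)) = 0" if p: "p \<in> K" for p
    proof -
      have "M $$ (p, i) = M $$ (p, j)"
        using arg_cong[OF ij(3), of "\<lambda>v. v $ p"] lt[OF p] lt[OF ij(1)] lt[OF ij(2)] M by simp
      moreover have "(\<Sum>q\<in>K. w q * M $$ (p, q)) = M $$ (p, i) - M $$ (p, j)"
        using fin ij unfolding w_def left_diff_distrib sum_subtractf
        by (simp add: of_bool_def if_distrib[of "\<lambda>x. x * _"] cong: if_cong)
      ultimately show ?thesis by simp
    qed
    then have "w i = 0" using ker ij(1) by blast
    then show False unfolding w_def using ij(4) by simp
  qed
  have "lin_indpt (col M ` K)"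
  proof (rule finite_lin_indpt2)
    show "finite (col M ` K)" using fin by simp
    show sub: "col M ` K \<subseteq> carrier_vec n" using M by auto
    fix \<alpha> assume z: "lincomb \<alpha> (col M ` K) = 0\<^sub>v n"
    have "\<forall>q\<in>K. \<alpha> (col M q) = 0"
    proof (rule ker)
      fix p assume p: "p \<in> K"
      have "lincomb \<alpha> (col M ` K) $ p = (\<Sum>q\<in>K. \<alpha> (col M q) * col M q $ p)"
        using lt[OF p] sub by (subst lincomb_index) (auto simp: sum.reindex[OF inj])
      moreover have "\<dots> = (\<Sum>q\<in>K. \<alpha> (col M q) * M $$ (p, q))"
        using lt[OF p] lt M by (intro sum.cong) auto
      ultimately show "(\<Sum>q\<in>K. \<alpha> (col M q) * M $$ (p, q)) = 0" using z lt[OF p] by simp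
    qed
    then show "\<forall>v\<in>col M ` K. \<alpha> v = 0" by simp
  qed
  moreover have "col M ` K \<subseteq> set (cols M)" using K M by (auto simp: cols_def)
  ultimately have "card (col M ` K) \<le> rank M" using rank_ge_card_indpt[OF M] by blast
  then show ?thesis using card_image[OF inj] by simp
qed

text \<open>Otherwise the average of the slack and \<open>Z\<close> would have larger rank than \<open>Z\<close>.\<close>

lemma slack_vanishes_outside_block:
  assumes rn: "r \<le> n" and B: "B \<in> carrier_mat n n"
    and max: "max_rank_slack n m A B (block_Z n r)" and S: "is_slack n m A B S"
    and ab: "a < n" "b < n" "r \<le> b"
  shows "S $$ (a, b) = 0"
proof -
  let ?Z = "block_Z n r"
  have psdS: "S \<in> carrier_mat n n" "psd_on {..<n} (ent S)"
    using S unfolding is_slack_def psd_iff by auto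
  have slZ: "is_slack n m A B ?Z" using max unfolding max_rank_slack_def by simp
  then have psdZ: "?Z \<in> carrier_mat n n" "psd_on {..<n} (ent ?Z)"
    unfolding is_slack_def psd_iff by auto
  have "S $$ (b, b) = 0"
  proof (rule ccontr)
    assume nz: "S $$ (b, b) \<noteq> 0"
    define M where "M = mat n n (\<lambda>(p, q). 1/2 * S $$ (p, q) + 1/2 * ?Z $$ (p, q))"
    have M: "M \<in> carrier_mat n n" unfolding M_def by simp
    have qM: "qform K (ent M) w = 1/2 * qform K (ent S) w + 1/2 * qform K (ent ?Z) w"
      if "K \<subseteq> {..<n}" for K w
    proof -
      have "qform K (ent M) w = qform K (\<lambda>p q. 1/2 * S $$ (p, q) + 1/2 * ?Z $$ (p, q)) w"
        using that by (intro qform_cong) (auto simp: M_def subset_iff)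
      then show ?thesis unfolding qform_eq_frob frob_add_left frob_scale_left .
    qed
    have psdM: "psd_on {..<n} (ent M)"
    proof -
      have "symmetric_on {..<n} (ent M)"
        using psdS(2) psdZ(2) unfolding psd_on_def symmetric_on_def by (auto simp: M_def)
      moreover have "0 \<le> qform {..<n} (ent M) w" for w
        using psdS(2) psdZ(2) qM[of "{..<n}" w] unfolding psd_on_def by simp
      ultimately show ?thesis unfolding psd_on_def by blast
    qed
    obtain x y where "S = B - mat_lincomb n n {1..m} x A" "?Z = B - mat_lincomb n n {1..m} y A"
      using S slZ unfolding is_slack_def by blast
    then have e: "S $$ (p, q) = B $$ (p, q) - (\<Sum>i=1..m. x i * A i $$ (p, q))"
      "?Z $$ (p, q) = B $$ (p, q) - (\<Sum>i=1..m. y i * A i $$ (p, q))" if "p < n" "q < n" for p q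
      using that B by simp_all
    have mean: "(\<Sum>i=1..m. (1/2 * x i + 1/2 * y i) * A i $$ (p, q)) =
        1/2 * (\<Sum>i=1..m. x i * A i $$ (p, q)) + 1/2 * (\<Sum>i=1..m. y i * A i $$ (p, q))" for p q
      unfolding sum_distrib_left sum.distrib[symmetric] by (intro sum.cong) (auto simp: algebra_simps)
    have "M = B - mat_lincomb n n {1..m} (\<lambda>i. 1/2 * x i + 1/2 * y i) A"
    proof (rule eq_matI)
      fix p q assume "p < dim_row (B - mat_lincomb n n {1..m} (\<lambda>i. 1/2 * x i + 1/2 * y i) A)"
        "q < dim_col (B - mat_lincomb n n {1..m} (\<lambda>i. 1/2 * x i + 1/2 * y i) A)"
      then have pq: "p < n" "q < n" by auto
      have "M $$ (p, q) = B $$ (p, q) - (\<Sum>i=1..m. (1/2 * x i + 1/2 * y i) * A i $$ (p, q))"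
        unfolding mean using pq e[OF pq] by (simp add: M_def field_simps)
      then show "M $$ (p, q) = (B - mat_lincomb n n {1..m} (\<lambda>i. 1/2 * x i + 1/2 * y i) A) $$ (p, q)"
        using pq B by simp
    qed (use M in auto)
    then have "is_slack n m A B M" using psdM M unfolding is_slack_def psd_iff by blast
    then have "vec_space.rank n M \<le> r"
      using max rank_block_Z_le[OF rn] unfolding max_rank_slack_def by (meson le_trans)
    \<comment> \<open>On these \<open>r + 1\<close> indices the average is definite: a zero of its
      form is a zero of both psd summands, \<open>Z\<close> kills the first \<open>r\<close>
      coordinates, and the positive entry \<open>S $$ (b, b)\<close> kills the last one.\<close>
    moreover have "card (insert b {..<r}) \<le> vec_space.rank n M"
    proof (rule card_le_rank_if_definite[OF M])
      show K: "insert b {..<r} \<subseteq> {..<n}" using ab rn by auto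
      fix w assume w0: "qform (insert b {..<r}) (ent M) w = 0"
      have "0 \<le> qform (insert b {..<r}) (ent S) w" "0 \<le> qform (insert b {..<r}) (ent ?Z) w"
        using psd_on_subset[OF _ K] psdS(2) psdZ(2) unfolding psd_on_def by auto
      then have qS: "qform (insert b {..<r}) (ent S) w = 0"
        and qZ: "qform (insert b {..<r}) (ent ?Z) w = 0"
        using w0 qM[OF K, of w] by auto
      have "qform (insert b {..<r}) (ent ?Z) w =
          qform (insert b {..<r}) (\<lambda>p q. of_bool (p = q)) (\<lambda>p. if p < r then w p else 0)"
        unfolding qform_def using ab rn by (auto intro!: sum.cong simp: block_Z_index[OF rn])
      then have "(\<Sum>p\<in>insert b {..<r}. (if p < r then w p else 0)\<^sup>2) = 0"
        using qZ by (simp add: qform_kronecker)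
      then have wr: "w p = 0" if "p < r" for p
        using that by (subst (asm) sum_nonneg_eq_0_iff) auto
      have "qform (insert b {..<r}) (ent S) w = frob (insert b {..<r}) (ent S) (\<lambda>p q. w p * w q)"
        by (rule qform_eq_frob)
      also have "\<dots> = qform {b} (ent S) w"
        unfolding frob_def qform_def using wr by (simp add: sum.insert_if)
      finally have "S $$ (b, b) * (w b * w b) = 0" using qS unfolding qform_def by simp
      then show "\<forall>p\<in>insert b {..<r}. w p = 0" using nz wr by auto
    qed
    ultimately show False using ab by simp
  qed
  then show ?thesis using psd_on_zero_diag(2)[OF _ psdS(2), of b a] ab by simp
qed

text \<open>A finite optimal value as a real least upper bound. The second conjunct also excludes
  infeasible systems, for which every \<open>w\<close> would be an upper bound.\<close>

definition is_primal_value ::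
  "nat \<Rightarrow> nat \<Rightarrow> (nat \<Rightarrow> real mat) \<Rightarrow> real mat \<Rightarrow> (nat \<Rightarrow> real) \<Rightarrow> real \<Rightarrow> bool" where
  "is_primal_value n m A B c v \<longleftrightarrow>
     (\<forall>x. sd_feasible_point n m A B x \<longrightarrow> (\<Sum>i=1..m. c i * x i) \<le> v) \<and>
     (\<forall>w. (\<forall>x. sd_feasible_point n m A B x \<longrightarrow> (\<Sum>i=1..m. c i * x i) \<le> w) \<longrightarrow> v \<le> w)"

lemma sdp_primal_value_eq_iff:
  "sdp_primal_value n m A B c = ereal v \<longleftrightarrow> is_primal_value n m A B c v"
proof
  assume v: "sdp_primal_value n m A B c = ereal v"
  show "is_primal_value n m A B c v"
    unfolding is_primal_value_def
  proof (intro conjI allI impI)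
    fix x assume "sd_feasible_point n m A B x"
    then have "ereal (\<Sum>i=1..m. c i * x i) \<le> sdp_primal_value n m A B c"
      unfolding sdp_primal_value_def by (intro SUP_upper) auto
    then show "(\<Sum>i=1..m. c i * x i) \<le> v" using v by simp
  next
    fix w assume "\<forall>x. sd_feasible_point n m A B x \<longrightarrow> (\<Sum>i=1..m. c i * x i) \<le> w"
    then have "sdp_primal_value n m A B c \<le> ereal w"
      unfolding sdp_primal_value_def by (intro SUP_least) auto
    then show "v \<le> w" using v by simp
  qed
next
  assume v: "is_primal_value n m A B c v"
  have "sdp_primal_value n m A B c \<le> ereal v"
    using v unfolding sdp_primal_value_def is_primal_value_def by (intro SUP_least) auto
  moreover have "ereal v \<le> sdp_primal_value n m A B c"
  proof (rule ccontr)
    assume "\<not> ?thesis"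
    then have "sdp_primal_value n m A B c < ereal v" by simp
    then obtain u where u: "sdp_primal_value n m A B c < ereal u" "u < v"
      using ereal_dense2 by force
    have "(\<Sum>i=1..m. c i * x i) \<le> u" if "sd_feasible_point n m A B x" for x
    proof -
      have "ereal (\<Sum>i=1..m. c i * x i) \<le> sdp_primal_value n m A B c"
        unfolding sdp_primal_value_def using that by (intro SUP_upper) auto
      then have "ereal (\<Sum>i=1..m. c i * x i) < ereal u" using u by (meson le_less_trans)
      then show ?thesis by simp
    qed
    then have "v \<le> u" using v unfolding is_primal_value_def by blast
    then show False using u by simp
  qed
  ultimately show "sdp_primal_value n m A B c = ereal v" by simp
qed

lemma badly_behaved_iff:
  "badly_behaved n m A B \<longleftrightarrow>
    (\<exists>c v. is_primal_value n m A B c v \<and>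
      \<not> (\<exists>Y. sdp_dual_feasible n m A c Y \<and> mat_inner B Y = v))"
proof -
  have "\<bar>sdp_primal_value n m A B c\<bar> \<noteq> \<infinity> \<longleftrightarrow> (\<exists>v. sdp_primal_value n m A B c = ereal v)" for c
    by (cases "sdp_primal_value n m A B c") auto
  then show ?thesis
    unfolding badly_behaved_def sdp_primal_value_eq_iff[symmetric] by fastforce
qed

section \<open>Invariance under elementary reformulations\<close>

text \<open>Operations (iii) and (iv) are both invertible changes of generators, so one transfer
  argument serves both. Carrying a two-sided inverse \<open>M\<close> of \<open>L\<close> along
  makes the relation symmetric without any matrix inversion.\<close>

definition lin_equiv :: "nat \<Rightarrow> nat \<Rightarrow> (nat \<Rightarrow> real mat) \<Rightarrow> (nat \<Rightarrow> real mat) \<Rightarrow> bool" where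
  "lin_equiv n m A A' \<longleftrightarrow> (\<exists>L M.
     (\<forall>i\<in>{1..m}. \<forall>k\<in>{1..m}. (\<Sum>j=1..m. L i j * M j k) = of_bool (i = k)) \<and>
     (\<forall>i\<in>{1..m}. \<forall>k\<in>{1..m}. (\<Sum>j=1..m. M i j * L j k) = of_bool (i = k)) \<and>
     (\<forall>i\<in>{1..m}. \<forall>a<n. \<forall>b<n. A' i $$ (a, b) = (\<Sum>j=1..m. L i j * A j $$ (a, b))))"

lemma sum_matrix_assoc:
  fixes x y :: "nat \<Rightarrow> real"
  assumes "finite S"
  shows "(\<Sum>i\<in>S. x i * (\<Sum>j\<in>S. L i j * y j)) = (\<Sum>j\<in>S. (\<Sum>i\<in>S. x i * L i j) * y j)"
  unfolding sum_distrib_left sum_distrib_right by (subst sum.swap) (simp add: mult.assoc)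

lemma sum_of_bool_eq:
  fixes f :: "nat \<Rightarrow> real"
  assumes "finite S" "i \<in> S"
  shows "(\<Sum>j\<in>S. of_bool (i = j) * f j) = f i" "(\<Sum>j\<in>S. of_bool (j = i) * f j) = f i"
    "(\<Sum>j\<in>S. f j * of_bool (i = j)) = f i" "(\<Sum>j\<in>S. f j * of_bool (j = i)) = f i"
  using assms by (simp_all add: of_bool_def if_distrib[of "\<lambda>x. x * _"] if_distrib[of "\<lambda>x. _ * x"] cong: if_cong)

lemma sum_inverse_matrices:
  fixes y :: "nat \<Rightarrow> real"
  assumes "finite S" "\<forall>i\<in>S. \<forall>k\<in>S. (\<Sum>j\<in>S. L i j * M j k) = of_bool (i = k)" "i \<in> S"
  shows "(\<Sum>j\<in>S. L i j * (\<Sum>k\<in>S. M j k * y k)) = y i"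
    "k \<in> S \<Longrightarrow> (\<Sum>j\<in>S. (\<Sum>i\<in>S. y i * L i j) * M j k) = y k"
proof -
  show "(\<Sum>j\<in>S. L i j * (\<Sum>k\<in>S. M j k * y k)) = y i"
    using assms by (simp add: sum_matrix_assoc sum_of_bool_eq)
  assume k: "k \<in> S"
  have "(\<Sum>j\<in>S. (\<Sum>i\<in>S. y i * L i j) * M j k) = (\<Sum>i\<in>S. y i * (\<Sum>j\<in>S. L i j * M j k))"
    using assms(1) by (simp add: sum_matrix_assoc)
  then show "(\<Sum>j\<in>S. (\<Sum>i\<in>S. y i * L i j) * M j k) = y k"
    using assms k by (simp add: sum_of_bool_eq)
qed

lemma lin_equiv_sym:
  assumes "lin_equiv n m A A'"
  shows "lin_equiv n m A' A"
proof -
  obtain L M where invLM: "\<forall>i\<in>{1..m}. \<forall>k\<in>{1..m}. (\<Sum>j=1..m. L i j * M j k) = of_bool (i = k)"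
    and invML: "\<forall>i\<in>{1..m}. \<forall>k\<in>{1..m}. (\<Sum>j=1..m. M i j * L j k) = of_bool (i = k)"
    and A': "\<forall>i\<in>{1..m}. \<forall>a<n. \<forall>b<n. A' i $$ (a, b) = (\<Sum>j=1..m. L i j * A j $$ (a, b))"
    using assms unfolding lin_equiv_def by blast
  have "A i $$ (a, b) = (\<Sum>j=1..m. M i j * A' j $$ (a, b))"
    if "i \<in> {1..m}" "a < n" "b < n" for i a b
    using sum_inverse_matrices(1)[OF _ invML that(1), of "\<lambda>k. A k $$ (a, b)"] A' that by simp
  then show ?thesis unfolding lin_equiv_def using invLM invML by blast
qed

text \<open>The change of variables is \<open>x' \<mapsto> x' L\<close> on primal points and \<open>c \<mapsto> L c\<close> on objectives.\<close>

lemma lin_equiv_transfer: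
  assumes eq: "lin_equiv n m A A'"
    and car: "\<forall>i\<in>{1..m}. A i \<in> carrier_mat n n"
      "\<forall>i\<in>{1..m}. A' i \<in> carrier_mat n n"
  obtains c' f g where
    "\<And>x. mat_lincomb n n {1..m} (f x) A = mat_lincomb n n {1..m} x A'"
    "\<And>x. mat_lincomb n n {1..m} (g x) A' = mat_lincomb n n {1..m} x A"
    "\<And>x. (\<Sum>i=1..m. c' i * x i) = (\<Sum>i=1..m. c i * f x i)"
    "\<And>x. (\<Sum>i=1..m. c' i * g x i) = (\<Sum>i=1..m. c i * x i)"
    "\<And>Y. sdp_dual_feasible n m A' c' Y \<Longrightarrow> sdp_dual_feasible n m A c Y"
proof -
  obtain L M where invLM: "\<forall>i\<in>{1..m}. \<forall>k\<in>{1..m}. (\<Sum>j=1..m. L i j * M j k) = of_bool (i = k)"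
    and invML: "\<forall>i\<in>{1..m}. \<forall>k\<in>{1..m}. (\<Sum>j=1..m. M i j * L j k) = of_bool (i = k)"
    and A': "\<And>i a b. i \<in> {1..m} \<Longrightarrow> a < n \<Longrightarrow> b < n \<Longrightarrow>
      A' i $$ (a, b) = (\<Sum>j=1..m. L i j * A j $$ (a, b))"
    using eq unfolding lin_equiv_def by blast
  define f where "f x j = (\<Sum>i=1..m. x i * L i j)" for x j
  define g where "g x j = (\<Sum>i=1..m. x i * M i j)" for x j
  define c' where "c' i = (\<Sum>j=1..m. L i j * c j)" for i
  have fg: "f (g x) i = x i" if "i \<in> {1..m}" for x i
    unfolding f_def g_def using sum_inverse_matrices(2)[OF _ invML that that] by simp
  have f: "mat_lincomb n n {1..m} (f x) A = mat_lincomb n n {1..m} x A'" for x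
  proof (rule eq_matI)
    fix a b assume ab: "a < dim_row (mat_lincomb n n {1..m} x A')" "b < dim_col (mat_lincomb n n {1..m} x A')"
    have "(\<Sum>i=1..m. x i * A' i $$ (a, b)) = (\<Sum>i=1..m. x i * (\<Sum>j=1..m. L i j * A j $$ (a, b)))"
      using A' ab by (intro sum.cong) auto
    also have "\<dots> = (\<Sum>j=1..m. f x j * A j $$ (a, b))"
      unfolding f_def by (rule sum_matrix_assoc) simp
    finally show "mat_lincomb n n {1..m} (f x) A $$ (a, b) = mat_lincomb n n {1..m} x A' $$ (a, b)"
      using ab by simp
  qed simp_all
  have cong: "mat_lincomb n n {1..m} (f (g x)) A = mat_lincomb n n {1..m} x A" for x
    unfolding mat_lincomb_def using fg by (auto intro!: cong_mat sum.cong)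
  have c: "(\<Sum>i=1..m. c' i * x i) = (\<Sum>i=1..m. c i * f x i)" for x
  proof -
    have "(\<Sum>i=1..m. x i * c' i) = (\<Sum>i=1..m. f x i * c i)"
      unfolding c'_def f_def by (rule sum_matrix_assoc) simp
    then show ?thesis by (simp add: mult.commute)
  qed
  show ?thesis
  proof (rule that[of f g c'])
    show "mat_lincomb n n {1..m} (f x) A = mat_lincomb n n {1..m} x A'" for x by (rule f)
    show "mat_lincomb n n {1..m} (g x) A' = mat_lincomb n n {1..m} x A" for x
      using f[of "g x"] cong[of x] by simp
    show "(\<Sum>i=1..m. c' i * x i) = (\<Sum>i=1..m. c i * f x i)" for x by (rule c)
    show "(\<Sum>i=1..m. c' i * g x i) = (\<Sum>i=1..m. c i * x i)" for x
      unfolding c using fg by (intro sum.cong) auto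
    fix Y assume Y: "sdp_dual_feasible n m A' c' Y"
    then have symY: "sym_mat n Y" unfolding sdp_dual_feasible_def psd_def by simp
    have inner: "mat_inner (A' i) Y = (\<Sum>j=1..m. L i j * mat_inner (A j) Y)" if i: "i \<in> {1..m}" for i
    proof -
      have "frob {..<n} (ent (A' i)) (ent Y) =
          frob {..<n} (\<lambda>a b. \<Sum>j=1..m. L i j * A j $$ (a, b)) (ent Y)"
        using A' i by (intro frob_cong) auto
      also have "\<dots> = (\<Sum>j=1..m. L i j * frob {..<n} (ent (A j)) (ent Y))"
        by (rule frob_comb_left)
      also have "\<dots> = (\<Sum>j=1..m. L i j * mat_inner (A j) Y)"
        using car by (intro sum.cong) (auto simp: mat_inner_eq_frob[OF _ symY])
      finally show ?thesis using car i by (simp add: mat_inner_eq_frob[OF _ symY])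
    qed
    have "mat_inner (A k) Y = c k" if k: "k \<in> {1..m}" for k
    proof -
      have "mat_inner (A k) Y = (\<Sum>i=1..m. M k i * (\<Sum>j=1..m. L i j * mat_inner (A j) Y))"
        using sum_inverse_matrices(1)[OF _ invML k] by simp
      also have "\<dots> = (\<Sum>i=1..m. M k i * (\<Sum>j=1..m. L i j * c j))"
        using inner Y unfolding sdp_dual_feasible_def c'_def by (intro sum.cong) auto
      also have "\<dots> = c k" using sum_inverse_matrices(1)[OF _ invML k] by simp
      finally show ?thesis .
    qed
    then show "sdp_dual_feasible n m A c Y" using Y unfolding sdp_dual_feasible_def by simp
  qed
qed

lemma badly_behaved_lin_equiv_imp:
  assumes eq: "lin_equiv n m A A'"
    and car: "\<forall>i\<in>{1..m}. A i \<in> carrier_mat n n"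
      "\<forall>i\<in>{1..m}. A' i \<in> carrier_mat n n"
    and bad: "badly_behaved n m A B"
  shows "badly_behaved n m A' B"
proof -
  obtain c v where v: "is_primal_value n m A B c v"
    and no: "\<not> (\<exists>Y. sdp_dual_feasible n m A c Y \<and> mat_inner B Y = v)"
    using bad unfolding badly_behaved_iff by blast
  obtain c' f g where f: "\<And>x. mat_lincomb n n {1..m} (f x) A = mat_lincomb n n {1..m} x A'"
    and g: "\<And>x. mat_lincomb n n {1..m} (g x) A' = mat_lincomb n n {1..m} x A"
    and cf: "\<And>x. (\<Sum>i=1..m. c' i * x i) = (\<Sum>i=1..m. c i * f x i)"
    and cg: "\<And>x. (\<Sum>i=1..m. c' i * g x i) = (\<Sum>i=1..m. c i * x i)"
    and dual: "\<And>Y. sdp_dual_feasible n m A' c' Y \<Longrightarrow> sdp_dual_feasible n m A c Y"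
    by (rule lin_equiv_transfer[OF eq car, of c]) (rule that; assumption)
  have feas: "sd_feasible_point n m A B (f x) \<longleftrightarrow> sd_feasible_point n m A' B x"
    "sd_feasible_point n m A' B (g x) \<longleftrightarrow> sd_feasible_point n m A B x" for x
    unfolding sd_feasible_point_def f g by simp_all
  have "is_primal_value n m A' B c' v"
    unfolding is_primal_value_def
  proof (intro conjI allI impI)
    show "(\<Sum>i=1..m. c' i * x i) \<le> v" if "sd_feasible_point n m A' B x" for x
      using v that unfolding cf is_primal_value_def feas(1)[symmetric] by blast
    fix w assume w: "\<forall>x. sd_feasible_point n m A' B x \<longrightarrow> (\<Sum>i=1..m. c' i * x i) \<le> w"
    have "(\<Sum>i=1..m. c i * x i) \<le> w" if "sd_feasible_point n m A B x" for x
      using w[rule_format, of "g x"] that unfolding cg feas(2) by blast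
    then show "v \<le> w" using v unfolding is_primal_value_def by blast
  qed
  then show ?thesis unfolding badly_behaved_iff using no dual by blast
qed

lemma badly_behaved_lin_equiv:
  assumes "lin_equiv n m A A'"
    and "\<forall>i\<in>{1..m}. A i \<in> carrier_mat n n"
      "\<forall>i\<in>{1..m}. A' i \<in> carrier_mat n n"
  shows "badly_behaved n m A B \<longleftrightarrow> badly_behaved n m A' B"
  using badly_behaved_lin_equiv_imp[OF assms] badly_behaved_lin_equiv_imp[OF lin_equiv_sym[OF assms(1)] assms(3,2)]
  by blast

lemma is_slack_lin_equiv:
  assumes "lin_equiv n m A A'"
    and "\<forall>i\<in>{1..m}. A i \<in> carrier_mat n n"
      "\<forall>i\<in>{1..m}. A' i \<in> carrier_mat n n"
  shows "is_slack n m A B S \<longleftrightarrow> is_slack n m A' B S"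
proof -
  obtain f g where "\<And>x. mat_lincomb n n {1..m} (f x) A = mat_lincomb n n {1..m} x A'"
    "\<And>x. mat_lincomb n n {1..m} (g x) A' = mat_lincomb n n {1..m} x A"
    \<comment> \<open>Only the maps between primal points are wanted; the objective is
      arbitrary.\<close>
    by (rule lin_equiv_transfer[OF assms, of undefined]) (rule that; assumption)
  then show ?thesis unfolding is_slack_def by metis
qed

lemma lin_equiv_combine:
  assumes i: "i \<in> {1..m}" and l: "l i \<noteq> 0"
  shows "lin_equiv n m A (A(i := mat_lincomb n n {1..m} l A))"
proof -
  define L where "L p j = (if p = i then l j else of_bool (p = j))" for p j
  \<comment> \<open>Row \<open>i\<close> expresses the old \<open>A i\<close>: subtract the other
    terms from the combination and divide by \<open>l i\<close>.\<close>
  define M where "M p j = (if p = i then (of_bool (j = i) - (if j = i then 0 else l j)) / l i else of_bool (p = j))" for p j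
  have split: "(\<Sum>j=1..m. h j) = h i + (\<Sum>j\<in>{1..m} - {i}. h j)" for h :: "nat \<Rightarrow> real"
    using i by (simp add: sum.remove)
  have off: "(\<Sum>j\<in>{1..m} - {i}. h j * of_bool (j = k)) = (if k = i then 0 else h k)"
    if "k \<in> {1..m}" for h :: "nat \<Rightarrow> real" and k
    using that sum_of_bool_eq(4)[of "{1..m} - {i}" k h] by auto
  have "(\<Sum>j=1..m. L p j * M j k) = of_bool (p = k)" if "p \<in> {1..m}" "k \<in> {1..m}" for p k
  proof (cases "p = i")
    case True
    have "(\<Sum>j\<in>{1..m} - {i}. L p j * M j k) = (\<Sum>j\<in>{1..m} - {i}. l j * of_bool (j = k))"
      unfolding L_def M_def True by (intro sum.cong) auto
    then show ?thesis unfolding split off[OF that(2)] using l True by (auto simp: L_def M_def)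
  next
    case False
    then have "(\<Sum>j=1..m. L p j * M j k) = (\<Sum>j=1..m. of_bool (p = j) * M j k)"
      unfolding L_def by simp
    then show ?thesis using False that by (simp add: sum_of_bool_eq M_def)
  qed
  moreover have "(\<Sum>j=1..m. M p j * L j k) = of_bool (p = k)" if "p \<in> {1..m}" "k \<in> {1..m}" for p k
  proof (cases "p = i")
    case True
    have "(\<Sum>j\<in>{1..m} - {i}. M p j * L j k) = (\<Sum>j\<in>{1..m} - {i}. (- l j / l i) * of_bool (j = k))"
      unfolding L_def M_def True by (intro sum.cong) auto
    then show ?thesis unfolding split off[OF that(2)] using l True by (auto simp: L_def M_def)
  next
    case False
    then have "(\<Sum>j=1..m. M p j * L j k) = (\<Sum>j=1..m. of_bool (p = j) * L j k)"
      unfolding M_def by simp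
    then show ?thesis using False that by (simp add: sum_of_bool_eq L_def)
  qed
  moreover have "(A(i := mat_lincomb n n {1..m} l A)) p $$ (a, b) = (\<Sum>j=1..m. L p j * A j $$ (a, b))"
    if "p \<in> {1..m}" "a < n" "b < n" for p a b
    using that by (auto simp: L_def sum_of_bool_eq)
  ultimately show ?thesis unfolding lin_equiv_def by blast
qed

lemma lin_equiv_exchange:
  assumes i: "i \<in> {1..m}" and j: "j \<in> {1..m}"
  shows "lin_equiv n m A (A(i := A j, j := A i))"
proof -
  define \<tau> where "\<tau> p = (if p = i then j else if p = j then i else p)" for p
  define L where "L p q = (of_bool (\<tau> p = q) :: real)" for p q
  have \<tau>: "\<tau> p \<in> {1..m}" if "p \<in> {1..m}" for p using that i j unfolding \<tau>_def by simp
  \<comment> \<open>The permutation matrix of a transposition is its own inverse, so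
    \<open>L\<close> also plays the role of \<open>M\<close>.\<close>
  have "(\<Sum>q=1..m. L p q * L q k) = of_bool (p = k)" if "p \<in> {1..m}" "k \<in> {1..m}" for p k
  proof -
    have "(\<Sum>q=1..m. L p q * L q k) = L (\<tau> p) k"
      unfolding L_def using \<tau>[OF that(1)] by (simp add: sum_of_bool_eq)
    then show ?thesis unfolding L_def \<tau>_def by auto
  qed
  moreover have "(A(i := A j, j := A i)) p $$ (a, b) = (\<Sum>q=1..m. L p q * A q $$ (a, b))"
    if "p \<in> {1..m}" for p a b
    unfolding L_def using \<tau>[OF that] by (simp add: sum_of_bool_eq) (simp add: \<tau>_def)
  ultimately show ?thesis unfolding lin_equiv_def by blast
qed

text \<open>Translating primal points by \<open>\<mu>\<close> moves the optimal value by
  \<open>s\<close>, and the constraints on \<open>Y\<close> move every dual value by the same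
  \<open>s\<close>, so a missing dual optimum stays missing.\<close>

lemma badly_behaved_shift_imp:
  assumes A: "\<forall>i\<in>{1..m}. A i \<in> carrier_mat n n" and B: "B \<in> carrier_mat n n"
    and bad: "badly_behaved n m A B"
  shows "badly_behaved n m A (B + mat_lincomb n n {1..m} \<mu> A)"
proof -
  let ?B = "B + mat_lincomb n n {1..m} \<mu> A"
  obtain c v where v: "is_primal_value n m A B c v"
    and no: "\<not> (\<exists>Y. sdp_dual_feasible n m A c Y \<and> mat_inner B Y = v)"
    using bad unfolding badly_behaved_iff by blast
  define s where "s = (\<Sum>i=1..m. c i * \<mu> i)"
  have "?B - mat_lincomb n n {1..m} x A = B - mat_lincomb n n {1..m} (\<lambda>i. x i - \<mu> i) A" for x
    using B by (intro eq_matI) (auto simp: left_diff_distrib sum_subtractf)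
  then have feas: "sd_feasible_point n m A ?B x \<longleftrightarrow> sd_feasible_point n m A B (\<lambda>i. x i - \<mu> i)" for x
    unfolding sd_feasible_point_def loewner_le_def by simp
  have obj: "(\<Sum>i=1..m. c i * (x i - \<mu> i)) = (\<Sum>i=1..m. c i * x i) - s" for x
    unfolding s_def by (simp add: right_diff_distrib sum_subtractf)
  have "is_primal_value n m A ?B c (v + s)"
    unfolding is_primal_value_def
  proof (intro conjI allI impI)
    fix x assume "sd_feasible_point n m A ?B x"
    then have "(\<Sum>i=1..m. c i * (x i - \<mu> i)) \<le> v"
      using v unfolding is_primal_value_def feas by blast
    then show "(\<Sum>i=1..m. c i * x i) \<le> v + s" unfolding obj by simp
  next
    fix w assume w: "\<forall>x. sd_feasible_point n m A ?B x \<longrightarrow> (\<Sum>i=1..m. c i * x i) \<le> w"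
    have "(\<Sum>i=1..m. c i * x i) \<le> w - s" if "sd_feasible_point n m A B x" for x
      using w[rule_format, of "\<lambda>i. x i + \<mu> i"] that obj[of "\<lambda>i. x i + \<mu> i"] unfolding feas by simp
    then have "v \<le> w - s" using v unfolding is_primal_value_def by blast
    then show "v + s \<le> w" by simp
  qed
  moreover have "mat_inner ?B Y = mat_inner B Y + s" if Y: "sdp_dual_feasible n m A c Y" for Y
  proof -
    have symY: "sym_mat n Y" using Y unfolding sdp_dual_feasible_def psd_def by simp
    have "frob {..<n} (ent ?B) (ent Y) =
        frob {..<n} (\<lambda>a b. B $$ (a, b) + (\<Sum>i=1..m. \<mu> i * A i $$ (a, b))) (ent Y)"
      using B by (intro frob_cong) auto
    also have "\<dots> = frob {..<n} (ent B) (ent Y) + (\<Sum>i=1..m. \<mu> i * frob {..<n} (ent (A i)) (ent Y))"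
      unfolding frob_add_left frob_comb_left ..
    also have "(\<Sum>i=1..m. \<mu> i * frob {..<n} (ent (A i)) (ent Y)) = s"
      unfolding s_def using Y A
      by (intro sum.cong) (auto simp: sdp_dual_feasible_def mat_inner_eq_frob[OF _ symY, symmetric])
    finally show ?thesis using B by (simp add: mat_inner_eq_frob[OF _ symY])
  qed
  ultimately show ?thesis unfolding badly_behaved_iff using no
    by (metis add_right_cancel)
qed

lemma badly_behaved_shift:
  assumes A: "\<forall>i\<in>{1..m}. A i \<in> carrier_mat n n" and B: "B \<in> carrier_mat n n"
  shows "badly_behaved n m A (B + mat_lincomb n n {1..m} \<mu> A) \<longleftrightarrow> badly_behaved n m A B"
proof
  let ?B = "B + mat_lincomb n n {1..m} \<mu> A"
  assume bad: "badly_behaved n m A ?B"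
  have "?B \<in> carrier_mat n n" using B by simp
  from badly_behaved_shift_imp[OF A this bad]
  have "badly_behaved n m A (?B + mat_lincomb n n {1..m} (\<lambda>i. - \<mu> i) A)" .
  also have "?B + mat_lincomb n n {1..m} (\<lambda>i. - \<mu> i) A = B"
    using B by (intro eq_matI) (auto simp: sum_negf)
  finally show "badly_behaved n m A B" .
qed (rule badly_behaved_shift_imp[OF A B])

section \<open>Congruence transformations\<close>

definition congruence :: "real mat \<Rightarrow> real mat \<Rightarrow> real mat" where
  "congruence T S = transpose_mat T * S * T"

lemma congruence_carrier:
  "T \<in> carrier_mat n n \<Longrightarrow> S \<in> carrier_mat n n \<Longrightarrow> congruence T S \<in> carrier_mat n n"
  unfolding congruence_def by simp

lemma congruence_index:
  assumes "T \<in> carrier_mat n n" "S \<in> carrier_mat n n" "a < n" "b < n"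
  shows "(congruence T S) $$ (a, b) =
    frob {..<n} (ent S) (\<lambda>p q. T $$ (p, a) * T $$ (q, b))"
proof -
  have "(transpose_mat T * S) $$ (a, q) = (\<Sum>p<n. T $$ (p, a) * S $$ (p, q))" if "q < n" for q
    using assms that by (auto intro!: sum.cong simp: scalar_prod_def lessThan_atLeast0)
  moreover have "(congruence T S) $$ (a, b) = (\<Sum>q<n. (transpose_mat T * S) $$ (a, q) * T $$ (q, b))"
    unfolding congruence_def using assms
    by (subst index_mult_mat) (auto intro!: sum.cong simp: scalar_prod_def lessThan_atLeast0 simp del: assoc_mult_mat)
  ultimately have "(congruence T S) $$ (a, b) =
      (\<Sum>q<n. (\<Sum>p<n. T $$ (p, a) * S $$ (p, q)) * T $$ (q, b))"
    by simp
  also have "\<dots> = (\<Sum>q<n. \<Sum>p<n. S $$ (p, q) * (T $$ (p, a) * T $$ (q, b)))"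
    by (simp add: sum_distrib_left sum_distrib_right algebra_simps)
  finally show ?thesis unfolding frob_def by (subst (asm) sum.swap)
qed

text \<open>The adjoint relation of congruences in coordinates: pairing \<open>P\<close> with
  \<open>T y T^T\<close> is pairing \<open>T^T P T\<close> with \<open>y\<close>.\<close>

lemma frob_double_sum:
  "frob I P (\<lambda>p q. \<Sum>a\<in>K. \<Sum>b\<in>K. t p a * t q b * y a b) =
    (\<Sum>a\<in>K. \<Sum>b\<in>K. frob I P (\<lambda>p q. t p a * t q b) * y a b)"
  unfolding frob_commute[of I P] frob_sum_left
  by (simp add: frob_scale_left[symmetric] mult.commute)

lemma symmetric_on_congruence:
  assumes "symmetric_on I P"
  shows "symmetric_on K (\<lambda>a b. frob I P (\<lambda>p q. t p a * t q b))"
  unfolding symmetric_on_def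
proof (intro ballI)
  fix a b
  have "frob I P (\<lambda>p q. t p a * t q b) = (\<Sum>q\<in>I. \<Sum>p\<in>I. P p q * (t p a * t q b))"
    unfolding frob_def by (rule sum.swap)
  also have "\<dots> = (\<Sum>q\<in>I. \<Sum>p\<in>I. P q p * (t q b * t p a))"
    using assms unfolding symmetric_on_def by (intro sum.cong) (auto intro!: sum.cong)
  finally show "frob I P (\<lambda>p q. t p a * t q b) = frob I P (\<lambda>p q. t p b * t q a)"
    unfolding frob_def .
qed

text \<open>The form of the congruent matrix at \<open>w\<close> is the form of \<open>P\<close> at
  the image of \<open>w\<close> under \<open>t\<close>.\<close>

lemma psd_on_congruence:
  assumes "psd_on I P"
  shows "psd_on K (\<lambda>a b. frob I P (\<lambda>p q. t p a * t q b))"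
  unfolding psd_on_def
proof (intro conjI allI)
  show "symmetric_on K (\<lambda>a b. frob I P (\<lambda>p q. t p a * t q b))"
    using assms unfolding psd_on_def by (blast intro: symmetric_on_congruence)
  fix w
  have "qform K (\<lambda>a b. frob I P (\<lambda>p q. t p a * t q b)) w =
      frob I P (\<lambda>p q. \<Sum>a\<in>K. \<Sum>b\<in>K. t p a * t q b * (w a * w b))"
    unfolding frob_double_sum qform_def ..
  also have "\<dots> = qform I P (\<lambda>p. \<Sum>a\<in>K. t p a * w a)"
    unfolding qform_eq_frob sum_product by (simp add: algebra_simps)
  finally show "0 \<le> qform K (\<lambda>a b. frob I P (\<lambda>p q. t p a * t q b)) w"
    using assms unfolding psd_on_def by simp
qed

lemma sym_mat_congruence:
  assumes T: "T \<in> carrier_mat n n" and S: "sym_mat n S"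
  shows "sym_mat n (congruence T S)"
proof -
  have Sc: "S \<in> carrier_mat n n" and symS: "symmetric_on {..<n} (ent S)"
    using S unfolding sym_mat_iff by auto
  have "symmetric_on {..<n} (ent (congruence T S))"
    using symmetric_on_congruence[OF symS, of "{..<n}" "\<lambda>p a. T $$ (p, a)"]
    unfolding symmetric_on_def by (simp add: congruence_index[OF T Sc])
  then show ?thesis unfolding sym_mat_iff using congruence_carrier[OF T Sc] by blast
qed

lemma congruence_inverse:
  assumes "T \<in> carrier_mat n n" "T' \<in> carrier_mat n n" "T * T' = 1\<^sub>m n" "S \<in> carrier_mat n n"
  shows "congruence T' (congruence T S) = S"
proof -
  have "transpose_mat T' * transpose_mat T = 1\<^sub>m n"
    using assms(3) transpose_mult[OF assms(1,2)] by simp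
  moreover have "congruence T' (congruence T S) =
      (transpose_mat T' * transpose_mat T) * S * (T * T')"
    unfolding congruence_def using assms by (simp add: assoc_mult_mat[of _ n n _ n _ n])
  ultimately show ?thesis using assms by simp
qed

lemma sd_feasible_point_congruence:
  assumes T: "T \<in> carrier_mat n n" and B: "B \<in> carrier_mat n n"
    and A: "\<forall>i\<in>{1..m}. A i \<in> carrier_mat n n"
    and A': "\<forall>i\<in>{1..m}. A' i = congruence T (A i)"
    and B': "B' = congruence T B"
    and feas: "sd_feasible_point n m A B x"
  shows "sd_feasible_point n m A' B' x"
proof -
  let ?t = "\<lambda>a b p q. T $$ (p, a) * T $$ (q, b)"
  have "psd_on {..<n} (\<lambda>a b. frob {..<n} (\<lambda>p q. B $$ (p, q) - (\<Sum>i=1..m. x i * A i $$ (p, q))) (?t a b))"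
    using feas B by (intro psd_on_congruence) (simp_all add: sd_feasible_point_iff)
  also have "?this \<longleftrightarrow> psd_on {..<n} (\<lambda>a b. B' $$ (a, b) - (\<Sum>i=1..m. x i * A' i $$ (a, b)))"
  proof (rule psd_on_cong)
    fix a b assume ab: "a \<in> {..<n}" "b \<in> {..<n}"
    have "(\<Sum>i=1..m. x i * A' i $$ (a, b)) = (\<Sum>i=1..m. x i * frob {..<n} (ent (A i)) (?t a b))"
      using A' ab A T by (intro sum.cong) (simp_all add: congruence_index)
    moreover have "B' $$ (a, b) = frob {..<n} (ent B) (?t a b)"
      using B' ab B T by (simp add: congruence_index)
    ultimately show "frob {..<n} (\<lambda>p q. B $$ (p, q) - (\<Sum>i=1..m. x i * A i $$ (p, q))) (?t a b) =
        B' $$ (a, b) - (\<Sum>i=1..m. x i * A' i $$ (a, b))"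
      unfolding frob_diff_left frob_comb_left by simp
  qed
  finally show ?thesis using B' congruence_carrier[OF T B] by (simp add: sd_feasible_point_iff)
qed

lemma badly_behaved_congruence_imp:
  assumes T: "T \<in> carrier_mat n n" "T' \<in> carrier_mat n n" "T * T' = 1\<^sub>m n"
    and B: "B \<in> carrier_mat n n"
    and A: "\<forall>i\<in>{1..m}. A i \<in> carrier_mat n n"
    and A': "\<forall>i\<in>{1..m}. A' i = congruence T (A i)"
    and B': "B' = congruence T B"
    and bad: "badly_behaved n m A B"
  shows "badly_behaved n m A' B'"
proof -
  obtain c v where v: "is_primal_value n m A B c v"
    and no: "\<not> (\<exists>Y. sdp_dual_feasible n m A c Y \<and> mat_inner B Y = v)"
    using bad unfolding badly_behaved_iff by blast
  have A'c: "\<forall>i\<in>{1..m}. A' i \<in> carrier_mat n n" using A' A congruence_carrier[OF T(1)] by simp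
  have B'c: "B' \<in> carrier_mat n n" using B' congruence_carrier[OF T(1) B] by simp
  have "sd_feasible_point n m A' B' x \<longleftrightarrow> sd_feasible_point n m A B x" for x
  proof
    assume "sd_feasible_point n m A' B' x"
    moreover have "\<forall>i\<in>{1..m}. A i = congruence T' (A' i)"
      using congruence_inverse[OF T] A A' by simp
    moreover have "B = congruence T' B'" using congruence_inverse[OF T B] B' by simp
    ultimately show "sd_feasible_point n m A B x"
      using sd_feasible_point_congruence[OF T(2) B'c A'c] by blast
  qed (rule sd_feasible_point_congruence[OF T(1) B A A' B'])
  then have "is_primal_value n m A' B' c v" using v unfolding is_primal_value_def by simp
  moreover have False if Y: "sdp_dual_feasible n m A' c Y" "mat_inner B' Y = v" for Y
  proof -
    have psdY: "psd_on {..<n} (ent Y)" and symY: "sym_mat n Y"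
      using Y(1) unfolding sdp_dual_feasible_def psd_iff by (auto simp: sym_mat_iff psd_on_def)
    \<comment> \<open>\<open>W\<close> is \<open>T Y T^T\<close>. By the adjoint relation its
      products with the old data equal those of \<open>Y\<close> with the new data, while primal
      points and objective stay the same.\<close>
    define W where "W = mat n n (\<lambda>(p, q). frob {..<n} (ent Y) (\<lambda>a b. T $$ (p, a) * T $$ (q, b)))"
    have "psd_on {..<n} (ent W) \<longleftrightarrow>
        psd_on {..<n} (\<lambda>p q. frob {..<n} (ent Y) (\<lambda>a b. T $$ (p, a) * T $$ (q, b)))"
      unfolding W_def by (intro psd_on_cong) auto
    then have psdW: "psd n W"
      unfolding psd_iff using psd_on_congruence[OF psdY, of "{..<n}" "\<lambda>a p. T $$ (p, a)"]
      by (simp add: W_def)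
    then have symW: "sym_mat n W" unfolding psd_def by simp
    have inner: "mat_inner S W = mat_inner (congruence T S) Y" if S: "S \<in> carrier_mat n n" for S
    proof -
      have "mat_inner (congruence T S) Y =
          frob {..<n} (ent (congruence T S)) (ent Y)"
        using congruence_carrier[OF T(1) S] symY by (rule mat_inner_eq_frob)
      also have "\<dots> = frob {..<n} (\<lambda>a b. frob {..<n} (ent S) (\<lambda>p q. T $$ (p, a) * T $$ (q, b))) (ent Y)"
        using S T by (intro frob_cong) (auto simp: congruence_index)
      also have "\<dots> = frob {..<n} (ent S)
          (\<lambda>p q. \<Sum>a<n. \<Sum>b<n. T $$ (p, a) * T $$ (q, b) * Y $$ (a, b))"
        unfolding frob_double_sum unfolding frob_def[of _ _ "ent Y"] ..
      also have "\<dots> = frob {..<n} (ent S) (ent W)"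
        by (intro frob_cong) (auto simp: W_def frob_def mult.commute)
      also have "\<dots> = mat_inner S W" using S symW by (simp add: mat_inner_eq_frob)
      finally show ?thesis by simp
    qed
    have "sdp_dual_feasible n m A c W"
      using Y(1) psdW A inner A' unfolding sdp_dual_feasible_def by simp
    moreover have "mat_inner B W = v" using Y(2) inner[OF B] B' by simp
    ultimately show False using no by blast
  qed
  ultimately show ?thesis unfolding badly_behaved_iff by blast
qed

lemma badly_behaved_congruence:
  assumes T: "T \<in> carrier_mat n n" "T' \<in> carrier_mat n n" "T * T' = 1\<^sub>m n" "T' * T = 1\<^sub>m n"
    and B: "B \<in> carrier_mat n n"
    and A: "\<forall>i\<in>{1..m}. A i \<in> carrier_mat n n"
  shows "badly_behaved n m (\<lambda>i. congruence T (A i)) (congruence T B) \<longleftrightarrow>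
    badly_behaved n m A B"
proof
  assume bad: "badly_behaved n m (\<lambda>i. congruence T (A i)) (congruence T B)"
  show "badly_behaved n m A B"
    by (rule badly_behaved_congruence_imp[OF T(2,1,4) _ _ _ _ bad])
      (simp_all add: A B congruence_carrier[OF T(1)] congruence_inverse[OF T(1-3)])
qed (rule badly_behaved_congruence_imp[OF T(1-3) B A], simp_all)

text \<open>The transfer lemmas need all current matrices to be square of size \<open>n\<close>, so
  symmetry is carried through the induction together with the equivalence.\<close>

lemma elementary_reformulation_invariant:
  assumes "elementary_reformulation n r m A B A' B'" and rn: "r \<le> n"
    and "\<And>i. i \<in> {1..m} \<Longrightarrow> sym_mat n (A i)" "sym_mat n B"
  shows "(\<forall>i\<in>{1..m}. sym_mat n (A' i)) \<and> sym_mat n B' \<and>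
    (badly_behaved n m A' B' \<longleftrightarrow> badly_behaved n m A B)"
  using assms(1)
proof (induction rule: elementary_reformulation.induct)
  case refl
  then show ?case using assms by simp
next
  case (rotate A' B' M T)
  have T: "T \<in> carrier_mat n n"
    using four_block_carrier_mat[of "1\<^sub>m r" r r M "n - r" "n - r"] rotate.hyps rn by simp
  then obtain T' where T': "T * T' = 1\<^sub>m n" "T' * T = 1\<^sub>m (dim_row T')"
    using rotate.hyps(4) unfolding invertible_mat_def inverts_mat_def by auto
  \<comment> \<open>\<open>invertible_mat\<close> leaves the dimensions of the inverse open; they
    are read off from the two identity matrices.\<close>
  have "dim_col T' = n" using arg_cong[OF T'(1), of dim_col] by simp
  moreover have "dim_row T' = n" using arg_cong[OF T'(2), of dim_col] T by simp
  ultimately have T'c: "T' \<in> carrier_mat n n" "T' * T = 1\<^sub>m n" using T' by auto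
  have "badly_behaved n m (\<lambda>i. congruence T (A' i)) (congruence T B') \<longleftrightarrow>
      badly_behaved n m A' B'"
    using rotate.IH by (intro badly_behaved_congruence[OF T T'c(1) T'(1) T'c(2)]) (auto simp: sym_mat_def)
  then show ?case using rotate.IH sym_mat_congruence[OF T] unfolding congruence_def by blast
next
  case (shift A' B' \<mu>)
  have "sym_mat n (B' + mat_lincomb n n {1..m} \<mu> A')"
    using shift.IH unfolding sym_mat_iff symmetric_on_def by (auto intro!: sum.cong)
  moreover have "badly_behaved n m A' (B' + mat_lincomb n n {1..m} \<mu> A') \<longleftrightarrow> badly_behaved n m A' B'"
    using shift.IH by (intro badly_behaved_shift) (auto simp: sym_mat_def)
  ultimately show ?case using shift.IH by blast
next
  case (exchange A' B' i j)
  have "\<forall>p\<in>{1..m}. sym_mat n ((A'(i := A' j, j := A' i)) p)" using exchange by simp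
  moreover from this
  have "badly_behaved n m A' B' \<longleftrightarrow> badly_behaved n m (A'(i := A' j, j := A' i)) B'"
    using exchange.IH exchange.hyps
    by (intro badly_behaved_lin_equiv lin_equiv_exchange) (auto simp: sym_mat_def)
  ultimately show ?case using exchange.IH by blast
next
  case (combine l A' B' i)
  have "sym_mat n (mat_lincomb n n {1..m} l A')"
    using combine.IH unfolding sym_mat_iff symmetric_on_def by (auto intro!: sum.cong)
  then have "\<forall>p\<in>{1..m}. sym_mat n ((A'(i := mat_lincomb n n {1..m} l A')) p)"
    using combine.IH by simp
  moreover from this
  have "badly_behaved n m A' B' \<longleftrightarrow> badly_behaved n m (A'(i := mat_lincomb n n {1..m} l A')) B'"
    using combine.IH combine.hyps
    by (intro badly_behaved_lin_equiv lin_equiv_combine) (auto simp: sym_mat_def)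
  ultimately show ?case using combine.IH by blast
qed

section \<open>Normal forms\<close>

text \<open>Only the products of cross entries have to vanish, so it suffices that one of the two
  factors is block diagonal.\<close>

lemma frob_Un_blocks:
  assumes "finite I" "finite J" "I \<inter> J = {}"
    and "\<And>a b. a \<in> I \<Longrightarrow> b \<in> J \<Longrightarrow> P a b * Q a b = 0 \<and> P b a * Q b a = 0"
  shows "frob (I \<union> J) P Q = frob I P Q + frob J P Q"
proof -
  have "(\<Sum>b\<in>I \<union> J. P a b * Q a b) = (\<Sum>b\<in>I. P a b * Q a b)" if "a \<in> I" for a
    using assms that by (subst sum.union_disjoint) auto
  moreover have "(\<Sum>b\<in>I \<union> J. P a b * Q a b) = (\<Sum>b\<in>J. P a b * Q a b)" if "a \<in> J" for a
    using assms that by (subst sum.union_disjoint) auto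
  ultimately show ?thesis
    unfolding frob_def using assms(1-3) by (subst sum.union_disjoint) auto
qed

lemma psd_on_Un_blocks:
  assumes IJ: "finite I" "finite J" "I \<inter> J = {}"
    and cross: "\<And>a b. a \<in> I \<Longrightarrow> b \<in> J \<Longrightarrow> P a b = 0 \<and> P b a = 0"
    and psd: "psd_on I P" "psd_on J P"
  shows "psd_on (I \<union> J) P"
proof -
  have "symmetric_on (I \<union> J) P"
    using cross psd unfolding psd_on_def symmetric_on_def by (metis Un_iff)
  moreover have "qform (I \<union> J) P w = qform I P w + qform J P w" for w
    unfolding qform_eq_frob using cross by (intro frob_Un_blocks[OF IJ]) simp
  ultimately show ?thesis using psd unfolding psd_on_def by simp
qed

lemma frob_reindex:
  assumes "inj_on f I"
  shows "frob (f ` I) P Q = frob I (\<lambda>a b. P (f a) (f b)) (\<lambda>a b. Q (f a) (f b))"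
  unfolding frob_def by (simp add: sum.reindex[OF assms])

lemma psd_on_reindex:
  assumes "inj_on f I" "psd_on I (\<lambda>a b. P (f a) (f b))"
  shows "psd_on (f ` I) P"
  using assms(2) unfolding psd_on_def symmetric_on_def qform_eq_frob frob_reindex[OF assms(1)] by simp

lemma psd_on_zero: "(\<And>a b. a \<in> I \<Longrightarrow> b \<in> I \<Longrightarrow> P a b = 0) \<Longrightarrow> psd_on I P"
  unfolding psd_on_def symmetric_on_def qform_def by simp

lemma lessThan_split: "r \<le> n \<Longrightarrow> {..<n} = {..<r} \<union> {r..<n}" for n r :: nat
  by auto

lemma tail_image: "{r..<n} = (\<lambda>a. a + r) ` {..<n - r}" for n r :: nat
proof -
  have "a \<in> (\<lambda>a. a + r) ` {..<n - r}" if "a \<in> {r..<n}" for a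
    using that by (intro image_eqI[of _ _ "a - r"]) auto
  then show ?thesis by auto
qed

lemma append_rows_index:
  assumes "G \<in> carrier_mat r q" "H \<in> carrier_mat s q" "a < r + s" "b < q"
  shows "(G @\<^sub>r H) $$ (a, b) = (if a < r then G $$ (a, b) else H $$ (a - r, b))"
  using assms unfolding append_rows_def by auto

lemma normal_shape_index:
  assumes sh: "normal_shape n r m k A B F G H" and rn: "r \<le> n" and i: "i \<in> {1..m}"
  shows "A i \<in> carrier_mat n n"
    and "a < r \<Longrightarrow> b < r \<Longrightarrow> A i $$ (a, b) = F i $$ (a, b)"
    and "i \<le> k \<Longrightarrow> a < n \<Longrightarrow> b < n \<Longrightarrow> r \<le> a \<or> r \<le> b \<Longrightarrow> A i $$ (a, b) = 0"
    and "k < i \<Longrightarrow> a < n \<Longrightarrow> b < n - r \<Longrightarrow> A i $$ (a, b + r) = (G i @\<^sub>r H i) $$ (a, b)"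
    and "k < i \<Longrightarrow> a < n - r \<Longrightarrow> b < n - r \<Longrightarrow> A i $$ (a + r, b + r) = H i $$ (a, b)"
proof -
  have F: "F i \<in> carrier_mat r r" using sh i unfolding normal_shape_def sym_mat_def by blast
  have GH: "G i \<in> carrier_mat r (n - r)" "H i \<in> carrier_mat (n - r) (n - r)"
    "A i = four_block_mat (F i) (G i) (transpose_mat (G i)) (H i)" if "k < i"
    using sh i that unfolding normal_shape_def sym_mat_def by auto
  have A0: "A i = four_block_mat (F i) (0\<^sub>m r (n - r)) (0\<^sub>m (n - r) r) (0\<^sub>m (n - r) (n - r))" if "i \<le> k"
    using sh i that unfolding normal_shape_def by auto
  show "A i \<in> carrier_mat n n"
  proof (cases "i \<le> k")
    case True
    then show ?thesis unfolding A0[OF True]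
      using four_block_carrier_mat[OF F zero_carrier_mat[of "n - r" "n - r"]] rn by simp
  next
    case False
    then show ?thesis using four_block_carrier_mat[OF F GH(2)] GH(3) rn by simp
  qed
  show "A i $$ (a, b) = F i $$ (a, b)" if "a < r" "b < r"
    using F GH A0 that by (cases "i \<le> k") (auto simp: not_le)
  show "A i $$ (a, b) = 0" if "i \<le> k" "a < n" "b < n" "r \<le> a \<or> r \<le> b"
    unfolding A0[OF that(1)] using F that by auto
  show "A i $$ (a, b + r) = (G i @\<^sub>r H i) $$ (a, b)" if "k < i" "a < n" "b < n - r"
    using F GH[OF that(1)] that rn by (auto simp: append_rows_index)
  show "A i $$ (a + r, b + r) = H i $$ (a, b)" if "k < i" "a < n - r" "b < n - r"
    using F GH[OF that(1)] that rn by auto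
qed

text \<open>In the last \<open>n - r\<close> columns the slack, \<open>Z\<close> and the matrices
  with index up to \<open>k\<close> all vanish. What remains is a linear relation among the stacked
  \<open>G i @\<^sub>r H i\<close>.\<close>

lemma feasible_tail_zero:
  assumes sh: "normal_shape n r m k A B F G H" and rn: "r \<le> n"
    and max: "max_rank_slack n m A B (block_Z n r)"
    and indep: "mat_lin_indep n (n - r) {k+1..m} (\<lambda>i. G i @\<^sub>r H i)"
    and feas: "sd_feasible_point n m A B x"
  shows "\<forall>i\<in>{k+1..m}. x i = 0"
proof (rule mat_lin_indepD[OF indep])
  fix a b assume ab: "a < n" "b < n - r"
  then have br: "b + r < n" by simp
  have B: "B = block_Z n r" using sh unfolding normal_shape_def by simp
  have Bc: "B \<in> carrier_mat n n" using B block_Z_carrier[OF rn] by simp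
  have "is_slack n m A B (B - mat_lincomb n n {1..m} x A)" using feas unfolding is_slack_iff by blast
  from slack_vanishes_outside_block[OF rn Bc max this ab(1) br]
  have "B $$ (a, b + r) - (\<Sum>i=1..m. x i * A i $$ (a, b + r)) = 0" using Bc ab br by simp
  moreover have "B $$ (a, b + r) = 0" unfolding B block_Z_index[OF rn ab(1) br] by simp
  ultimately have "(\<Sum>i=1..m. x i * A i $$ (a, b + r)) = 0" by simp
  moreover have "(\<Sum>i=1..m. x i * A i $$ (a, b + r)) = (\<Sum>i=k+1..m. x i * A i $$ (a, b + r))"
    using normal_shape_index(3)[OF sh rn] ab br by (intro sum.mono_neutral_right) auto
  moreover have "\<dots> = (\<Sum>i=k+1..m. x i * (G i @\<^sub>r H i) $$ (a, b))"
    using normal_shape_index(4)[OF sh rn] ab by (intro sum.cong) auto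
  ultimately show "(\<Sum>i=k+1..m. x i * (G i @\<^sub>r H i) $$ (a, b)) = 0" by simp
qed

text \<open>Every feasible \<open>x\<close> has \<open>x\<^sub>m = 0\<close>, so the objective \<open>- x\<^sub>m\<close> has optimal value \<open>0\<close>; a dual
  solution of value \<open>0\<close> is supported on the lower right block, where \<open>H\<^sub>m\<close> is psd.\<close>

lemma bad_normal_form_badly_behaved:
  assumes rn: "r \<le> n" and bad: "bad_normal_form n r m A B"
  shows "badly_behaved n m A B"
proof -
  obtain k F G H where k: "k < m" and sh: "normal_shape n r m k A B F G H"
    and max: "max_rank_slack n m A B (block_Z n r)"
    and indep: "mat_lin_indep n (n - r) {k+1..m} (\<lambda>i. G i @\<^sub>r H i)"
    and psdH: "psd (n - r) (H m)"
    using bad unfolding bad_normal_form_def by blast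
  have m: "m \<in> {1..m}" using k by simp
  define c where "c i = (if i = m then -1 else 0 :: real)" for i
  have obj: "(\<Sum>i=1..m. c i * x i) = - x m" for x
    using m unfolding c_def by (simp add: if_distrib[of "\<lambda>y. y * _"] cong: if_cong)
  have xm: "x m = 0" if "sd_feasible_point n m A B x" for x
    using feasible_tail_zero[OF sh rn max indep that] k by simp
  obtain x0 where "sd_feasible_point n m A B x0"
    using max unfolding max_rank_slack_def is_slack_iff by blast
  then have "is_primal_value n m A B c 0"
    unfolding is_primal_value_def obj using xm by force
  moreover have False if Y: "sdp_dual_feasible n m A c Y" "mat_inner B Y = 0" for Y
  proof -
    have B: "B = block_Z n r" using sh unfolding normal_shape_def by simp
    have psdY: "psd_on {..<n} (ent Y)" and symY: "sym_mat n Y"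
      using Y(1) unfolding sdp_dual_feasible_def psd_iff by (auto simp: sym_mat_iff psd_on_def)
    have nn: "0 \<le> Y $$ (a, a)" if "a < n" for a using psd_on_diag_nonneg[OF _ psdY] that by simp
    \<comment> \<open>The dual value is the trace of the upper left block of \<open>Y\<close>. If it
      is zero, that block has zero diagonal and \<open>Y\<close> vanishes in its first
      \<open>r\<close> rows and columns.\<close>
    have "0 = frob {..<n} (ent (block_Z n r)) (ent Y)"
      using Y(2) mat_inner_eq_frob[OF block_Z_carrier[OF rn] symY] B by simp
    also have "\<dots> = frob ({..<r} \<union> {r..<n}) (ent (block_Z n r)) (ent Y)"
      using lessThan_split[OF rn] by simp
    also have "\<dots> = frob {..<r} (ent (block_Z n r)) (ent Y) + frob {r..<n} (ent (block_Z n r)) (ent Y)"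
      using rn by (intro frob_Un_blocks) (auto simp: block_Z_index[OF rn])
    also have "frob {r..<n} (ent (block_Z n r)) (ent Y) = 0"
      unfolding frob_def by (intro sum.neutral ballI) (auto simp: block_Z_index[OF rn])
    also have "frob {..<r} (ent (block_Z n r)) (ent Y) = frob {..<r} (\<lambda>a b. of_bool (a = b)) (ent Y)"
      using rn by (intro frob_cong) (auto simp: block_Z_index[OF rn])
    finally have "(\<Sum>a<r. Y $$ (a, a)) = 0" by (simp add: frob_kronecker)
    then have diag: "Y $$ (a, a) = 0" if "a < r" for a
      using nn that rn sum_nonneg_eq_0_iff[of "{..<r}" "\<lambda>a. Y $$ (a, a)"] by auto
    have Y0: "Y $$ (a, b) = 0" "Y $$ (b, a) = 0" if "a < r" "b < n" for a b
      using psd_on_zero_diag[OF _ psdY, of a b] diag that rn by auto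
    have "mat_inner (A m) Y = frob ({..<r} \<union> {r..<n}) (ent (A m)) (ent Y)"
      using mat_inner_eq_frob[OF normal_shape_index(1)[OF sh rn m] symY] lessThan_split[OF rn] by simp
    also have "\<dots> = frob {..<r} (ent (A m)) (ent Y) + frob {r..<n} (ent (A m)) (ent Y)"
      by (intro frob_Un_blocks) (auto simp: Y0)
    also have "frob {..<r} (ent (A m)) (ent Y) = 0"
      unfolding frob_def using rn by (intro sum.neutral ballI) (auto simp: Y0)
    also have "0 + frob {r..<n} (ent (A m)) (ent Y) \<ge> 0"
    proof -
      have "psd_on {..<n - r} (ent (H m)) \<longleftrightarrow> psd_on {..<n - r} (\<lambda>a b. A m $$ (a + r, b + r))"
        using normal_shape_index(5)[OF sh rn m k] by (intro psd_on_cong) auto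
      then have "psd_on {r..<n} (ent (A m))"
        using psdH unfolding psd_iff tail_image by (intro psd_on_reindex) auto
      moreover have "psd_on {r..<n} (ent Y)" by (rule psd_on_subset[OF _ _ psdY]) auto
      ultimately show ?thesis using frob_psd_nonneg[of "{r..<n}"] by simp
    qed
    finally have "0 \<le> mat_inner (A m) Y" by simp
    moreover have "mat_inner (A m) Y = -1"
      using Y(1) m unfolding sdp_dual_feasible_def c_def by simp
    ultimately show False by simp
  qed
  ultimately show ?thesis unfolding badly_behaved_iff by blast
qed

text \<open>The components \<open>x\<^sub>i\<close> with \<open>i > k\<close> vanish at feasible points, which leaves a problem on the
  upper left block with strictly feasible point \<open>0\<close>. A dual solution of that problem is completed by
  a lower right block, which exists since the \<open>H\<^sub>i\<close> are independent and orthogonal to \<open>U\<close>.\<close>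

lemma good_normal_form_well_behaved:
  assumes rn: "r \<le> n" and good: "good_normal_form n r m A B"
  shows "\<not> badly_behaved n m A B"
proof -
  obtain k F G H U where k: "k \<le> m" and sh: "normal_shape n r m k A B F G H"
    and max: "max_rank_slack n m A B (block_Z n r)"
    and indepH: "mat_lin_indep (n - r) (n - r) {k+1..m} H"
    and U: "posdef (n - r) U" and HU: "\<forall>i\<in>{k+1..m}. mat_inner (H i) U = 0"
    using good unfolding good_normal_form_def by blast
  have B: "B = block_Z n r" using sh unfolding normal_shape_def by simp
  have Bc: "B \<in> carrier_mat n n" using B block_Z_carrier[OF rn] by simp
  have symF: "symmetric_on {..<r} (ent (F i))" if "i \<in> {1..m}" for i
    using sh that unfolding normal_shape_def sym_mat_iff by blast
  have GH: "G i \<in> carrier_mat r (n - r)" "H i \<in> carrier_mat (n - r) (n - r)"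
    "symmetric_on {..<n - r} (ent (H i))" if "i \<in> {k+1..m}" for i
    using sh that unfolding normal_shape_def sym_mat_iff by auto
  \<comment> \<open>Independence of the \<open>H i\<close> passes to the taller stacked matrices,
    which makes \<open>feasible_tail_zero\<close> available in the good form too.\<close>
  have indep: "mat_lin_indep n (n - r) {k+1..m} (\<lambda>i. G i @\<^sub>r H i)"
  proof (rule mat_lin_indepI)
    fix x assume z: "\<And>a b. a < n \<Longrightarrow> b < n - r \<Longrightarrow> (\<Sum>i=k+1..m. x i * (G i @\<^sub>r H i) $$ (a, b)) = 0"
    show "\<forall>i\<in>{k+1..m}. x i = 0"
    proof (rule mat_lin_indepD[OF indepH])
      fix a b assume ab: "a < n - r" "b < n - r"
      have "(\<Sum>i=k+1..m. x i * H i $$ (a, b)) = (\<Sum>i=k+1..m. x i * (G i @\<^sub>r H i) $$ (a + r, b))"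
        using ab rn by (intro sum.cong) (simp_all add: append_rows_index[OF GH(1,2)])
      then show "(\<Sum>i=k+1..m. x i * H i $$ (a, b)) = 0" using z[of "a + r" b] ab by simp
    qed
  qed
  have "\<exists>Y. sdp_dual_feasible n m A c Y \<and> mat_inner B Y = v" if v: "is_primal_value n m A B c v" for c v
  proof -
    have trunc: "(\<Sum>i=1..m. g i * x i) = (\<Sum>i=1..k. g i * x i)"
      if "\<forall>i\<in>{k+1..m}. x i = 0" for g x :: "nat \<Rightarrow> real"
      using that k by (intro sum.mono_neutral_right) auto
    let ?P = "\<lambda>x a b. of_bool (a = b) - (\<Sum>i=1..k. x i * F i $$ (a, b))"
    \<comment> \<open>With vanishing tail the slack is zero outside the upper left block, where
      \<open>Z\<close> is the identity: exactly the form required by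
      \<open>slater_strong_duality\<close>.\<close>
    have block: "psd_on {..<n} (\<lambda>a b. B $$ (a, b) - (\<Sum>i=1..m. x i * A i $$ (a, b))) \<longleftrightarrow>
        psd_on {..<r} (?P x)" if x: "\<forall>i\<in>{k+1..m}. x i = 0" for x
    proof -
      let ?S = "\<lambda>a b. B $$ (a, b) - (\<Sum>i=1..m. x i * A i $$ (a, b))"
      have S: "?S a b = B $$ (a, b) - (\<Sum>i=1..k. x i * A i $$ (a, b))" for a b
        using trunc[OF x, of "\<lambda>i. A i $$ (a, b)"] by (simp add: mult.commute)
      have "(\<Sum>i=1..k. x i * A i $$ (a, b)) = (\<Sum>i=1..k. x i * F i $$ (a, b))" if "a < r" "b < r" for a b
        using normal_shape_index(2)[OF sh rn] that k by (intro sum.cong) auto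
      then have "psd_on {..<r} ?S \<longleftrightarrow> psd_on {..<r} (?P x)"
        unfolding S using rn by (intro psd_on_cong) (auto simp: B block_Z_index[OF rn])
      moreover have "?S a b = 0" if "a < n" "b < n" "r \<le> a \<or> r \<le> b" for a b
      proof -
        have "(\<Sum>i=1..k. x i * A i $$ (a, b)) = 0"
          using normal_shape_index(3)[OF sh rn] that k by (intro sum.neutral) auto
        then show ?thesis unfolding S using that by (auto simp: B block_Z_index[OF rn])
      qed
      then have "psd_on {..<r} ?S \<Longrightarrow> psd_on ({..<r} \<union> {r..<n}) ?S"
        by (intro psd_on_Un_blocks psd_on_zero[of "{r..<n}"]) (use rn in auto)
      moreover have "psd_on {..<n} ?S \<Longrightarrow> psd_on {..<r} ?S"
        by (rule psd_on_subset) (use rn in auto)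
      ultimately show ?thesis using lessThan_split[OF rn] by auto
    qed
    have "\<exists>Y. psd_on {..<r} Y \<and> (\<forall>i\<in>{1..k}. frob {..<r} (ent (F i)) Y = c i) \<and> (\<Sum>a<r. Y a a) = v"
    proof (rule slater_strong_duality)
      show "symmetric_on {..<r} (ent (F i))" if "i \<in> {1..k}" for i using symF k that by simp
    next
      fix x assume P: "psd_on {..<r} (?P x)"
      let ?x = "\<lambda>i. if i \<le> k then x i else 0"
      have "psd_on {..<r} (?P ?x) \<longleftrightarrow> psd_on {..<r} (?P x)"
        by (intro psd_on_cong) (auto intro!: sum.cong)
      then have "sd_feasible_point n m A B ?x"
        using P block[of ?x] by (simp add: sd_feasible_point_iff[OF Bc])
      then have "(\<Sum>i=1..m. c i * ?x i) \<le> v" using v unfolding is_primal_value_def by blast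
      also have "(\<Sum>i=1..m. c i * ?x i) = (\<Sum>i=1..k. c i * ?x i)" by (rule trunc) simp
      also have "\<dots> = (\<Sum>i=1..k. c i * x i)" by (intro sum.cong) auto
      finally show "(\<Sum>i=1..k. c i * x i) \<le> v" .
    next
      fix w assume w: "\<And>x. psd_on {..<r} (?P x) \<Longrightarrow> (\<Sum>i=1..k. c i * x i) \<le> w"
      have "(\<Sum>i=1..m. c i * x i) \<le> w" if "sd_feasible_point n m A B x" for x
      proof -
        have x: "\<forall>i\<in>{k+1..m}. x i = 0" by (rule feasible_tail_zero[OF sh rn max indep that])
        then have "psd_on {..<r} (?P x)" using that block by (simp add: sd_feasible_point_iff[OF Bc])
        then show ?thesis using w trunc[OF x, of c] by simp
      qed
      then show "v \<le> w" using v unfolding is_primal_value_def by blast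
    qed simp_all
    then obtain Y1 where Y1: "psd_on {..<r} Y1" "\<forall>i\<in>{1..k}. frob {..<r} (ent (F i)) Y1 = c i"
      "(\<Sum>a<r. Y1 a a) = v" by blast
    \<comment> \<open>For a block diagonal dual matrix the product with \<open>A i\<close> is that
      of \<open>F i\<close> with \<open>Y1\<close> plus that of \<open>H i\<close> with the lower
      block, so the lower block must supply the difference. It does not change the dual value, since
      \<open>Z\<close> vanishes there.\<close>
    have "\<exists>Y. psd_on {..<n - r} Y \<and>
        (\<forall>i\<in>{k+1..m}. frob {..<n - r} (ent (H i)) Y = c i - frob {..<r} (ent (F i)) Y1)"
    proof (rule psd_with_prescribed_products)
      show "symmetric_on {..<n - r} (ent (H i))" if "i \<in> {k+1..m}" for i using GH that by blast
      show "\<forall>i\<in>{k+1..m}. x i = 0"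
        if "\<And>a b. a \<in> {..<n - r} \<Longrightarrow> b \<in> {..<n - r} \<Longrightarrow> (\<Sum>i=k+1..m. x i * H i $$ (a, b)) = 0" for x
        using that by (intro mat_lin_indepD[OF indepH]) auto
      show "posdef_on {..<n - r} (ent U)" using U unfolding posdef_iff by blast
      show "frob {..<n - r} (ent (H i)) (ent U) = 0" if "i \<in> {k+1..m}" for i
        using HU that mat_inner_eq_frob[OF GH(2)[OF that], of U] U unfolding posdef_def by auto
    qed simp_all
    then obtain Y2 where Y2: "psd_on {..<n - r} Y2"
      "\<forall>i\<in>{k+1..m}. frob {..<n - r} (ent (H i)) Y2 = c i - frob {..<r} (ent (F i)) Y1" by blast
    define Y where "Y = mat n n (\<lambda>(a, b). if a < r \<and> b < r then Y1 a b
      else if r \<le> a \<and> r \<le> b then Y2 (a - r) (b - r) else 0)"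
    have Yc: "Y \<in> carrier_mat n n" unfolding Y_def by simp
    have Ytop: "Y $$ (a, b) = Y1 a b" if "a < r" "b < r" for a b using that rn unfolding Y_def by simp
    have Ybot: "Y $$ (a + r, b + r) = Y2 a b" if "a < n - r" "b < n - r" for a b
      using that unfolding Y_def by simp
    have Ycross: "Y $$ (a, b) = 0 \<and> Y $$ (b, a) = 0" if "a \<in> {..<r}" "b \<in> {r..<n}" for a b
      using that rn unfolding Y_def by auto
    have "psd_on {..<r} (ent Y) \<longleftrightarrow> psd_on {..<r} Y1"
      using Ytop by (intro psd_on_cong) auto
    moreover have "psd_on {r..<n} (ent Y)"
    proof -
      have "psd_on {..<n - r} (\<lambda>a b. Y $$ (a + r, b + r)) \<longleftrightarrow> psd_on {..<n - r} Y2"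
        using Ybot by (intro psd_on_cong) auto
      then show ?thesis using Y2(1) unfolding tail_image by (intro psd_on_reindex) auto
    qed
    ultimately have "psd_on {..<n} (ent Y)"
      unfolding lessThan_split[OF rn] using Y1(1) Ycross by (intro psd_on_Un_blocks) auto
    then have psdY: "psd n Y" unfolding psd_iff using Yc by blast
    then have symY: "sym_mat n Y" unfolding psd_def by simp
    have split: "mat_inner S Y =
        frob {..<r} (ent S) Y1 + frob {..<n - r} (\<lambda>a b. S $$ (a + r, b + r)) Y2"
      if S: "S \<in> carrier_mat n n" for S
    proof -
      have "mat_inner S Y = frob ({..<r} \<union> {r..<n}) (ent S) (ent Y)"
        using mat_inner_eq_frob[OF S symY] lessThan_split[OF rn] by simp
      also have "\<dots> = frob {..<r} (ent S) (ent Y) + frob {r..<n} (ent S) (ent Y)"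
        using Ycross by (intro frob_Un_blocks) auto
      also have "frob {..<r} (ent S) (ent Y) = frob {..<r} (ent S) Y1"
        using Ytop by (intro frob_cong) auto
      also have "frob {r..<n} (ent S) (ent Y) =
          frob {..<n - r} (\<lambda>a b. S $$ (a + r, b + r)) (\<lambda>a b. Y $$ (a + r, b + r))"
        unfolding tail_image by (rule frob_reindex) simp
      also have "\<dots> = frob {..<n - r} (\<lambda>a b. S $$ (a + r, b + r)) Y2"
        using Ybot by (intro frob_cong) auto
      finally show ?thesis .
    qed
    have "mat_inner (A i) Y = c i" if i: "i \<in> {1..m}" for i
    proof -
      have top: "frob {..<r} (ent (A i)) Y1 = frob {..<r} (ent (F i)) Y1"
        using normal_shape_index(2)[OF sh rn i] by (intro frob_cong) auto
      show ?thesis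
      proof (cases "i \<le> k")
        case True
        have "frob {..<n - r} (\<lambda>a b. A i $$ (a + r, b + r)) Y2 = 0"
          unfolding frob_def using normal_shape_index(3)[OF sh rn i True]
          by (intro sum.neutral ballI) auto
        then show ?thesis
          using split[OF normal_shape_index(1)[OF sh rn i]] top Y1(2) True i by simp
      next
        case False
        then have ki: "k < i" by simp
        have "frob {..<n - r} (\<lambda>a b. A i $$ (a + r, b + r)) Y2 = frob {..<n - r} (ent (H i)) Y2"
          using normal_shape_index(5)[OF sh rn i ki] by (intro frob_cong) auto
        then show ?thesis
          using split[OF normal_shape_index(1)[OF sh rn i]] top Y2(2) ki i by simp
      qed
    qed
    moreover have "mat_inner B Y = v"
    proof -
      have "frob {..<r} (ent B) Y1 = frob {..<r} (\<lambda>a b. of_bool (a = b)) Y1"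
        using rn by (intro frob_cong) (auto simp: B block_Z_index[OF rn])
      moreover have "frob {..<n - r} (\<lambda>a b. B $$ (a + r, b + r)) Y2 = 0"
        unfolding frob_def by (intro sum.neutral ballI) (auto simp: B block_Z_index[OF rn])
      ultimately show ?thesis using split[OF Bc] Y1(3) by (simp add: frob_kronecker)
    qed
    ultimately show ?thesis using psdY unfolding sdp_dual_feasible_def by blast
  qed
  then show ?thesis unfolding badly_behaved_iff by blast
qed

section \<open>Existence of one of the two normal forms\<close>

definition ul_block :: "nat \<Rightarrow> real mat \<Rightarrow> real mat" where
  "ul_block r S = mat r r (\<lambda>(a, b). S $$ (a, b))"

definition ur_block :: "nat \<Rightarrow> nat \<Rightarrow> real mat \<Rightarrow> real mat" where
  "ur_block n r S = mat r (n - r) (\<lambda>(a, b). S $$ (a, b + r))"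

definition lr_block :: "nat \<Rightarrow> nat \<Rightarrow> real mat \<Rightarrow> real mat" where
  "lr_block n r S = mat (n - r) (n - r) (\<lambda>(a, b). S $$ (a + r, b + r))"

text \<open>For symmetric matrices this is the shape with only an upper left block. As a condition
  on the last columns alone it matches the stacked matrices in the independence condition.\<close>

definition right_part_zero :: "nat \<Rightarrow> nat \<Rightarrow> real mat \<Rightarrow> bool" where
  "right_part_zero n r S \<longleftrightarrow> (\<forall>a<n. \<forall>b<n. r \<le> b \<longrightarrow> S $$ (a, b) = 0)"

lemma sym_mat_blocks:
  assumes "sym_mat n S" "r \<le> n"
  shows "sym_mat r (ul_block r S)" "sym_mat (n - r) (lr_block n r S)"
    "S = four_block_mat (ul_block r S) (ur_block n r S) (transpose_mat (ur_block n r S)) (lr_block n r S)"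
proof -
  have S: "S \<in> carrier_mat n n" and sym: "\<And>a b. a < n \<Longrightarrow> b < n \<Longrightarrow> S $$ (a, b) = S $$ (b, a)"
    using assms(1) unfolding sym_mat_iff symmetric_on_def by auto
  show "sym_mat r (ul_block r S)"
    unfolding sym_mat_iff symmetric_on_def ul_block_def using sym assms(2) by auto
  show "sym_mat (n - r) (lr_block n r S)"
    unfolding sym_mat_iff symmetric_on_def lr_block_def using sym assms(2) by auto
  show "S = four_block_mat (ul_block r S) (ur_block n r S) (transpose_mat (ur_block n r S)) (lr_block n r S)"
    using S assms(2) by (intro eq_matI) (auto simp: ul_block_def ur_block_def lr_block_def intro: sym)
qed

lemma right_part_zero_blocks:
  assumes "sym_mat n S" "r \<le> n" "right_part_zero n r S"
  shows "S = four_block_mat (ul_block r S) (0\<^sub>m r (n - r)) (0\<^sub>m (n - r) r) (0\<^sub>m (n - r) (n - r))"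
proof -
  have "ur_block n r S = 0\<^sub>m r (n - r)" "lr_block n r S = 0\<^sub>m (n - r) (n - r)"
    using assms(2,3) unfolding right_part_zero_def ur_block_def lr_block_def by (auto intro!: eq_matI)
  then show ?thesis using sym_mat_blocks(3)[OF assms(1,2)] by simp
qed

lemma normal_shape_blocks:
  assumes "r \<le> n" "k \<le> m" "\<forall>i\<in>{1..m}. sym_mat n (A i)" "\<forall>i\<in>{1..k}. right_part_zero n r (A i)"
  shows "normal_shape n r m k A (block_Z n r)
    (\<lambda>i. ul_block r (A i)) (\<lambda>i. ur_block n r (A i)) (\<lambda>i. lr_block n r (A i))"
  unfolding normal_shape_def
proof (intro conjI ballI)
  fix i
  show "sym_mat r (ul_block r (A i))" if "i \<in> {1..m}" using sym_mat_blocks(1) assms that by blast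
  show "ur_block n r (A i) \<in> carrier_mat r (n - r)" unfolding ur_block_def by simp
  show "sym_mat (n - r) (lr_block n r (A i))" if "i \<in> {k+1..m}"
    using assms that by (intro sym_mat_blocks(2)) auto
  show "A i = four_block_mat (ul_block r (A i)) (0\<^sub>m r (n - r)) (0\<^sub>m (n - r) r) (0\<^sub>m (n - r) (n - r))"
    if "i \<in> {1..k}" using assms that by (intro right_part_zero_blocks) auto
  show "A i = four_block_mat (ul_block r (A i)) (ur_block n r (A i))
      (transpose_mat (ur_block n r (A i))) (lr_block n r (A i))" if "i \<in> {k+1..m}"
    using assms that by (intro sym_mat_blocks(3)) auto
qed simp

lemma sym_mat_lincomb:
  assumes "\<forall>i\<in>I. sym_mat n (A i)"
  shows "sym_mat n (mat_lincomb n n I x A)"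
  using assms unfolding sym_mat_iff symmetric_on_def by (auto intro!: sum.cong)

text \<open>Equality of the slack sets is what carries the maximality of the rank of
  \<open>Z\<close> to the reformulated system.\<close>

definition fixed_slack_reformulation ::
  "nat \<Rightarrow> nat \<Rightarrow> nat \<Rightarrow> (nat \<Rightarrow> real mat) \<Rightarrow> real mat \<Rightarrow> (nat \<Rightarrow> real mat) \<Rightarrow> bool" where
  "fixed_slack_reformulation n r m A B A' \<longleftrightarrow>
     elementary_reformulation n r m A B A' (block_Z n r) \<and>
     (\<forall>i\<in>{1..m}. sym_mat n (A' i)) \<and>
     (\<forall>S. is_slack n m A' (block_Z n r) S \<longleftrightarrow> is_slack n m A B S)"

lemma fixed_slack_reformulation_start:
  assumes B: "sym_mat n B" and A: "\<forall>i\<in>{1..m}. sym_mat n (A i)"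
    and Z: "is_slack n m A B (block_Z n r)"
  shows "fixed_slack_reformulation n r m A B A"
proof -
  let ?c = "\<lambda>x. mat_lincomb n n {1..m} x A"
  have Bc: "B \<in> carrier_mat n n" using B unfolding sym_mat_def by simp
  obtain x where x: "block_Z n r = B - ?c x" using Z unfolding is_slack_def by blast
  \<comment> \<open>Operation (ii) with the negative of the point whose slack is
    \<open>Z\<close>.\<close>
  have "block_Z n r = B + ?c (\<lambda>i. - x i)"
    unfolding x using Bc by (intro eq_matI) (auto simp: sum_negf)
  then have "elementary_reformulation n r m A B A (block_Z n r)"
    using elementary_reformulation.shift[OF elementary_reformulation.refl] by simp
  moreover have "(\<exists>y. S = block_Z n r - ?c y) \<longleftrightarrow> (\<exists>y. S = B - ?c y)" for S
  proof -
    have "block_Z n r - ?c y = B - ?c (\<lambda>i. x i + y i)" for y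
      unfolding x using Bc by (intro eq_matI) (auto simp: distrib_right sum.distrib)
    moreover have "B - ?c y = block_Z n r - ?c (\<lambda>i. y i - x i)" for y
      unfolding x using Bc by (intro eq_matI) (auto simp: left_diff_distrib sum_subtractf)
    ultimately show ?thesis by metis
  qed
  ultimately show ?thesis unfolding fixed_slack_reformulation_def is_slack_def using A by simp
qed

lemma fixed_slack_reformulation_lin_equiv:
  assumes R: "fixed_slack_reformulation n r m A B A'"
    and "elementary_reformulation n r m A B A'' (block_Z n r)"
    and "lin_equiv n m A' A''" and sym: "\<forall>i\<in>{1..m}. sym_mat n (A'' i)"
  shows "fixed_slack_reformulation n r m A B A''"
proof -
  have "is_slack n m A' (block_Z n r) S \<longleftrightarrow> is_slack n m A'' (block_Z n r) S" for S
    using assms unfolding fixed_slack_reformulation_def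
    by (intro is_slack_lin_equiv) (auto simp: sym_mat_def)
  then show ?thesis using assms unfolding fixed_slack_reformulation_def by simp
qed

text \<open>The combination is put into position \<open>i\<close> by operation (iv) at \<open>j\<close> and an exchange.\<close>

lemma fixed_slack_reformulation_combine_at:
  assumes R: "fixed_slack_reformulation n r m A B A'"
    and ij: "i \<in> {1..m}" "j \<in> {1..m}" and l: "l j \<noteq> 0"
  obtains A'' where "fixed_slack_reformulation n r m A B A''"
    and "A'' i = mat_lincomb n n {1..m} l A'"
    and "\<And>p. p \<noteq> i \<Longrightarrow> p \<noteq> j \<Longrightarrow> A'' p = A' p"
proof -
  define A1 where "A1 = A'(j := mat_lincomb n n {1..m} l A')"
  have A': "elementary_reformulation n r m A B A' (block_Z n r)" "\<forall>i\<in>{1..m}. sym_mat n (A' i)"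
    using R unfolding fixed_slack_reformulation_def by auto
  have e1: "elementary_reformulation n r m A B A1 (block_Z n r)"
    unfolding A1_def by (rule elementary_reformulation.combine[where l = l, OF A'(1) ij(2) l])
  have s1: "\<forall>i\<in>{1..m}. sym_mat n (A1 i)"
    unfolding A1_def using A'(2) sym_mat_lincomb[OF A'(2)] by simp
  have R1: "fixed_slack_reformulation n r m A B A1"
    using lin_equiv_combine[OF ij(2), of l n A'] l e1 s1 unfolding A1_def
    by (intro fixed_slack_reformulation_lin_equiv[OF R]) auto
  show ?thesis
  proof (cases "i = j")
    case True
    then show ?thesis using that[of A1] R1 unfolding A1_def by simp
  next
    case False
    let ?A2 = "A1(i := A1 j, j := A1 i)"
    have "fixed_slack_reformulation n r m A B ?A2"
    proof (rule fixed_slack_reformulation_lin_equiv[OF R1])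
      show "elementary_reformulation n r m A B ?A2 (block_Z n r)"
        by (rule elementary_reformulation.exchange[OF e1 ij False])
      show "lin_equiv n m A1 ?A2" by (rule lin_equiv_exchange[OF ij])
      show "\<forall>i\<in>{1..m}. sym_mat n (?A2 i)" using s1 ij by simp
    qed
    then show ?thesis using that[of ?A2] False unfolding A1_def by simp
  qed
qed

lemma bad_or_good_reformulation:
  assumes rn: "r \<le> n" and A: "\<forall>i\<in>{1..m}. sym_mat n (A i)" and B: "sym_mat n B"
    and max: "max_rank_slack n m A B (block_Z n r)"
  shows "has_bad_reformulation n r m A B \<or> has_good_reformulation n r m A B"
proof -
  let ?Z = "block_Z n r"
  \<comment> \<open>Maximality of \<open>k\<close> yields the independence of the remaining \<open>(G\<^sub>i, H\<^sub>i)\<close> for every such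
    reformulation, so it need not be checked again after further operations.\<close>
  define T where "T k A' \<longleftrightarrow> fixed_slack_reformulation n r m A B A' \<and>
    (\<forall>i\<in>{1..k}. right_part_zero n r (A' i))" for k A'
  define K where "K = {k\<in>{..m}. \<exists>A'. T k A'}"
  define k where "k = Max K"
  have "T 0 A"
    using fixed_slack_reformulation_start[OF B A] max unfolding T_def max_rank_slack_def by simp
  then have K: "finite K" "0 \<in> K" unfolding K_def by auto
  then have "k \<in> K" unfolding k_def using Max_in by blast
  then obtain A' where km: "k \<le> m" and T: "T k A'" unfolding K_def by blast
  have greatest: "k' \<le> k" if "k' \<le> m" "T k' A''" for k' A''
    unfolding k_def using K(1) that by (intro Max_ge) (auto simp: K_def)
  have Tsym: "sym_mat n (A'' i)" if "T k A''" "i \<in> {1..m}" for A'' i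
    using that unfolding T_def fixed_slack_reformulation_def by blast
  have shape: "normal_shape n r m k A'' ?Z
    (\<lambda>i. ul_block r (A'' i)) (\<lambda>i. ur_block n r (A'' i)) (\<lambda>i. lr_block n r (A'' i))" if "T k A''" for A''
    using that unfolding T_def fixed_slack_reformulation_def
    by (intro normal_shape_blocks[OF rn km]) auto
  have maxT: "max_rank_slack n m A'' ?Z ?Z" if "T k A''" for A''
    using max that unfolding T_def fixed_slack_reformulation_def max_rank_slack_def by simp
  have stack: "(ur_block n r S @\<^sub>r lr_block n r S) $$ (a, b) = S $$ (a, b + r)"
    if "a < n" "b < n - r" for S a b
    using that rn by (subst append_rows_index[of _ r "n - r" _ "n - r"])
      (auto simp: ur_block_def lr_block_def)
  \<comment> \<open>Operation (iv) combines over all of \<open>{1..m}\<close>; zero coefficients up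
    to \<open>k\<close> restrict it to the tail.\<close>
  define cut where "cut x i = (if i \<in> {k+1..m} then x i else 0)" for x :: "nat \<Rightarrow> real" and i
  have cut: "(\<Sum>i=1..m. cut x i * f i) = (\<Sum>i=k+1..m. x i * f i)" for x f
    unfolding cut_def by (rule sum.mono_neutral_cong_right) auto
  \<comment> \<open>A dependency among the tail could be combined into position
    \<open>k + 1\<close>. That matrix would lose its right part, and \<open>k + 1\<close> matrices
    of this kind contradict the choice of \<open>k\<close>.\<close>
  have indep: "mat_lin_indep n (n - r) {k+1..m} (\<lambda>i. ur_block n r (A'' i) @\<^sub>r lr_block n r (A'' i))"
    if T: "T k A''" for A''
  proof (rule mat_lin_indepI, rule ccontr)
    fix x assume z: "\<And>a b. a < n \<Longrightarrow> b < n - r \<Longrightarrow>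
        (\<Sum>i=k+1..m. x i * (ur_block n r (A'' i) @\<^sub>r lr_block n r (A'' i)) $$ (a, b)) = 0"
      and "\<not> (\<forall>i\<in>{k+1..m}. x i = 0)"
    then obtain j where j: "j \<in> {k+1..m}" "x j \<noteq> 0" by blast
    then have idx: "k + 1 \<in> {1..m}" "j \<in> {1..m}" and cj: "cut x j \<noteq> 0" unfolding cut_def by auto
    have R: "fixed_slack_reformulation n r m A B A''" using T unfolding T_def by simp
    obtain A2 where A2: "fixed_slack_reformulation n r m A B A2"
      "A2 (k + 1) = mat_lincomb n n {1..m} (cut x) A''"
      "\<And>p. p \<noteq> k + 1 \<Longrightarrow> p \<noteq> j \<Longrightarrow> A2 p = A'' p"
      using fixed_slack_reformulation_combine_at[OF R idx, of "cut x"] cj by metis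
    have "right_part_zero n r (A2 (k + 1))"
      unfolding right_part_zero_def A2(2)
    proof (intro allI impI)
      fix a b assume ab: "a < n" "b < n" "r \<le> b"
      then have "b - r < n - r" by simp
      from z[OF ab(1) this] have "(\<Sum>i=k+1..m. x i * A'' i $$ (a, b)) = 0"
        using stack[OF ab(1) \<open>b - r < n - r\<close>] ab by simp
      then show "mat_lincomb n n {1..m} (cut x) A'' $$ (a, b) = 0"
        using ab cut[of x "\<lambda>i. A'' i $$ (a, b)"] by simp
    qed
    moreover have "right_part_zero n r (A2 p)" if "p \<in> {1..k}" for p
      using T A2(3)[of p] j that unfolding T_def by auto
    ultimately have "\<forall>p\<in>{1..k + 1}. right_part_zero n r (A2 p)"
      by (auto simp: le_Suc_eq)
    then have "T (k + 1) A2" using A2(1) unfolding T_def by blast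
    then show False using greatest[of "k + 1" A2] idx by simp
  qed
  show ?thesis
  \<comment> \<open>The two cases are the two sides of the alternative in
    \<open>posdef_orthogonal_exists\<close>.\<close>
  proof (cases "\<exists>x. psd_on {..<n - r} (\<lambda>a b. \<Sum>i=k+1..m. x i * A' i $$ (a + r, b + r)) \<and>
      (\<exists>j\<in>{k+1..m}. x j \<noteq> 0)")
    case True
    then obtain x j where x: "psd_on {..<n - r} (\<lambda>a b. \<Sum>i=k+1..m. x i * A' i $$ (a + r, b + r))"
      and j: "j \<in> {k+1..m}" "x j \<noteq> 0" by blast
    then have idx: "m \<in> {1..m}" "j \<in> {1..m}" and cj: "cut x j \<noteq> 0" and k: "k < m"
      unfolding cut_def by auto
    have R: "fixed_slack_reformulation n r m A B A'" using T unfolding T_def by simp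
    obtain A2 where A2: "fixed_slack_reformulation n r m A B A2"
      "A2 m = mat_lincomb n n {1..m} (cut x) A'"
      "\<And>p. p \<noteq> m \<Longrightarrow> p \<noteq> j \<Longrightarrow> A2 p = A' p"
      using fixed_slack_reformulation_combine_at[OF R idx, of "cut x"] cj by metis
    \<comment> \<open>Only the positions \<open>m\<close> and \<open>j\<close>, both beyond
      \<open>k\<close>, were touched. So \<open>T k A2\<close> holds, and with it independence is
      available again.\<close>
    have "right_part_zero n r (A2 p)" if "p \<in> {1..k}" for p
      using T A2(3)[of p] j k that unfolding T_def by auto
    then have T2: "T k A2" using A2(1) unfolding T_def by blast
    have "psd_on {..<n - r} (ent (lr_block n r (A2 m)))"
    proof -
      have "lr_block n r (A2 m) $$ (a, b) = (\<Sum>i=k+1..m. x i * A' i $$ (a + r, b + r))"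
        if "a < n - r" "b < n - r" for a b
        using that cut[of x "\<lambda>i. A' i $$ (a + r, b + r)"] by (simp add: lr_block_def A2(2))
      then have "psd_on {..<n - r} (ent (lr_block n r (A2 m))) \<longleftrightarrow>
          psd_on {..<n - r} (\<lambda>a b. \<Sum>i=k+1..m. x i * A' i $$ (a + r, b + r))"
        by (intro psd_on_cong) auto
      then show ?thesis using x by blast
    qed
    then have "psd (n - r) (lr_block n r (A2 m))" unfolding psd_iff by (simp add: lr_block_def)
    then have "bad_normal_form n r m A2 ?Z"
      unfolding bad_normal_form_def using k shape[OF T2] maxT[OF T2] indep[OF T2] by blast
    then show ?thesis
      using A2(1) unfolding has_bad_reformulation_def fixed_slack_reformulation_def by blast
  next
    case False
    then have only0: "\<forall>i\<in>{k+1..m}. x i = 0"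
      if "psd_on {..<n - r} (\<lambda>a b. \<Sum>i=k+1..m. x i * A' i $$ (a + r, b + r))" for x
      using that by blast
    have "\<exists>U. posdef_on {..<n - r} U \<and>
        (\<forall>i\<in>{k+1..m}. frob {..<n - r} (\<lambda>a b. A' i $$ (a + r, b + r)) U = 0)"
    proof (rule posdef_orthogonal_exists)
      show "symmetric_on {..<n - r} (\<lambda>a b. A' i $$ (a + r, b + r))" if "i \<in> {k+1..m}" for i
        using Tsym[OF T, of i] that unfolding sym_mat_iff symmetric_on_def by auto
    qed (use only0 in auto)
    then obtain U where U: "posdef_on {..<n - r} U"
      "\<forall>i\<in>{k+1..m}. frob {..<n - r} (\<lambda>a b. A' i $$ (a + r, b + r)) U = 0" by blast
    define V where "V = mat (n - r) (n - r) (\<lambda>(a, b). U a b)"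
    have "qform {..<n - r} (ent V) w = qform {..<n - r} U w" for w
      unfolding V_def by (rule qform_cong) auto
    then have V: "posdef (n - r) V"
      using U(1) unfolding posdef_iff posdef_on_def symmetric_on_def by (simp add: V_def)
    have "mat_inner (lr_block n r (A' i)) V = 0" if i: "i \<in> {k+1..m}" for i
    proof -
      have "mat_inner (lr_block n r (A' i)) V = frob {..<n - r} (ent (lr_block n r (A' i))) (ent V)"
        using V unfolding posdef_def by (intro mat_inner_eq_frob) (auto simp: lr_block_def)
      also have "\<dots> = frob {..<n - r} (\<lambda>a b. A' i $$ (a + r, b + r)) U"
        by (intro frob_cong) (auto simp: lr_block_def V_def)
      finally show ?thesis using U(2) i by simp
    qed
    \<comment> \<open>A relation among the lower right blocks has zero combination, which is psd, so
      the case assumption forces its coefficients to vanish.\<close>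
    moreover have "mat_lin_indep (n - r) (n - r) {k+1..m} (\<lambda>i. lr_block n r (A' i))"
    proof (rule mat_lin_indepI, rule only0, rule psd_on_zero)
      fix x and a b
      assume "\<And>a b. a < n - r \<Longrightarrow> b < n - r \<Longrightarrow> (\<Sum>i=k+1..m. x i * lr_block n r (A' i) $$ (a, b)) = 0"
        and "a \<in> {..<n - r}" "b \<in> {..<n - r}"
      then show "(\<Sum>i=k+1..m. x i * A' i $$ (a + r, b + r)) = 0" by (simp add: lr_block_def)
    qed
    ultimately have "good_normal_form n r m A' ?Z"
      unfolding good_normal_form_def using km shape[OF T] maxT[OF T] V by blast
    then show ?thesis
      using T unfolding has_good_reformulation_def T_def fixed_slack_reformulation_def by blast
  qed
qed

theorem corollary1:
  fixes n m r :: nat and A :: "nat \<Rightarrow> real mat" and B :: "real mat"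
  assumes "\<And>i. i \<in> {1..m} \<Longrightarrow> sym_mat n (A i)"
    and "sym_mat n B"
    and "sd_feasible n m A B"
    and "r \<le> n"
    and "max_rank_slack n m A B (block_Z n r)"
  shows "(badly_behaved n m A B \<longleftrightarrow> has_bad_reformulation n r m A B) \<and>
         (well_behaved n m A B \<longleftrightarrow> has_good_reformulation n r m A B)"
proof -
  have "badly_behaved n m A' B' \<longleftrightarrow> badly_behaved n m A B"
    if "elementary_reformulation n r m A B A' B'" for A' B'
    using elementary_reformulation_invariant[OF that assms(4,1,2)] by blast
  then have "has_bad_reformulation n r m A B \<Longrightarrow> badly_behaved n m A B"
    and "has_good_reformulation n r m A B \<Longrightarrow> \<not> badly_behaved n m A B"
    unfolding has_bad_reformulation_def has_good_reformulation_def
    using bad_normal_form_badly_behaved[OF assms(4)] good_normal_form_well_behaved[OF assms(4)]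
    by blast+
  \<comment> \<open>Since the two kinds of reformulation imply opposite behaviour and one of them
    always exists, each implication becomes an equivalence.\<close>
  moreover have "has_bad_reformulation n r m A B \<or> has_good_reformulation n r m A B"
    using bad_or_good_reformulation[OF assms(4) _ assms(2,5)] assms(1) by blast
  ultimately show ?thesis unfolding well_behaved_def by blast
qed

end
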